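(* $[2,0,0,2]=5$.
   Context: $\mathcal{Q}_n$ is the $n$-dimensional binary hypercube: its vertices are all binary sequences of length $n$, adjacent iff they differ in exactly one position. A vertex is even or odd according to the parity of its number of 1's; vertices of one parity are called red and those of the other parity green. A path covering of a graph is a set of vertex-disjoint paths that cover all vertices of the graph. A fault $\mathcal{F}$ in $\mathcal{Q}_n$ is a set of deleted vertices; its mass is $|\mathcal{F}|$ and its charge is $|r(\mathcal{F})-g(\mathcal{F})|$, where $r(\mathcal{F})$, $g(\mathcal{F})$ are the numbers of red and green vertices in $\mathcal{F}$. $\mathcal{Q}_n-\mathcal{F}$ is the subgraph induced by the non-deleted vertices. A pair of vertices (or a path, via its two endpoints) is neutral if the two vertices have opposite parity and charged if they have the same parity; a charged pair is red (green) if its elements are red (green). A set $\mathcal{E}$ of disjoint pairs of vertices is in balance with $\mathcal{F}$ if all vertices in the pairs lie in $\mathcal{Q}_n-\mathcal{F}$ and $r(\mathcal{F})-g(\mathcal{F})=g(\mathcal{E})-r(\mathcal{E})$, where $r(\mathcal{E})$, $g(\mathcal{E})$ are the numbers of red and green pairs in $\mathcal{E}$. For a fault $\mathcal{F}$ of mass $M$ and charge $C$ in $\mathcal{Q}_n$, one can freely prescribe ends for a path covering of $\mathcal{Q}_n-\mathcal{F}$ with $N$ neutral paths and $O$ charged paths if (i) there is at least one set $\mathcal{E}$ of disjoint pairs of vertices in balance with $\mathcal{F}$ containing exactly $N$ neutral and $O$ charged pairs, and (ii) for every such $\mathcal{E}$ there is a path covering of $\mathcal{Q}_n-\mathcal{F}$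 whose set of pairs of end vertices is $\mathcal{E}$. For nonnegative integers $M,C,N,O$, $\mathcal{A}_{M,C,N,O}$ is the set of nonnegative integers $m$ such that $m\ge\log_2[M+C+2N+2O]$ and for every $n\ge m$ and every fault $\mathcal{F}$ of mass $M$ and charge $C$ in $\mathcal{Q}_n$ one can freely prescribe ends for a path covering of $\mathcal{Q}_n-\mathcal{F}$ with $N$ neutral and $O$ charged paths. $[M,C,N,O]$ is the smallest element of $\mathcal{A}_{M,C,N,O}$ if this set is nonempty (so an equality $[M,C,N,O]=m$ includes the assertion that the set is nonempty). *)

theory Defs
  imports Complex_Main
begin

section \<open>The binary hypercube\<close>

type_synonym vertex = "bool list"

definition hypercube :: "nat \<Rightarrow> vertex set" where
  "hypercube n = {v. length v = n}"

definition adj :: "vertex \<Rightarrow> vertex \<Rightarrow> bool" where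
  "adj u v \<longleftrightarrow> length u = length v \<and> card {i. i < length u \<and> u ! i \<noteq> v ! i} = 1"

text \<open>Which parity is called red is immaterial: every notion below is invariant under
  exchanging the two colours.\<close>

definition red :: "vertex \<Rightarrow> bool" where
  "red v \<longleftrightarrow> even (count_list v True)"

definition green :: "vertex \<Rightarrow> bool" where
  "green v \<longleftrightarrow> odd (count_list v True)"


section \<open>Path coverings\<close>

text \<open>A path is given by the list of its vertices in order. A list and its reverse describe the
  same path; as the members of a covering have disjoint vertex sets, no path occurs in a covering
  under two descriptions.\<close>

definition is_path :: "'a set \<Rightarrow> ('a \<Rightarrow> 'a \<Rightarrow> bool) \<Rightarrow> 'a list \<Rightarrow> bool" where
  "is_path V E p \<longleftrightarrow> p \<noteq> [] \<and> set p \<subseteq> V \<and> distinct p \<and> successively E p"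

definition path_covering :: "'a set \<Rightarrow> ('a \<Rightarrow> 'a \<Rightarrow> bool) \<Rightarrow> 'a list set \<Rightarrow> bool" where
  "path_covering V E P \<longleftrightarrow>
     (\<forall>p\<in>P. is_path V E p) \<and>
     (\<forall>p\<in>P. \<forall>q\<in>P. p \<noteq> q \<longrightarrow> set p \<inter> set q = {}) \<and>
     (\<Union>p\<in>P. set p) = V"

definition path_ends :: "'a list \<Rightarrow> 'a set" where
  "path_ends p = {hd p, last p}"


section \<open>Faults and pairs of vertices\<close>

definition is_fault :: "nat \<Rightarrow> vertex set \<Rightarrow> bool" where
  "is_fault n F \<longleftrightarrow> F \<subseteq> hypercube n"

definition mass :: "vertex set \<Rightarrow> nat" where
  "mass F = card F"

definition red_minus_green :: "vertex set \<Rightarrow> int" where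
  "red_minus_green F = int (card {v\<in>F. red v}) - int (card {v\<in>F. green v})"

definition charge :: "vertex set \<Rightarrow> nat" where
  "charge F = nat \<bar>red_minus_green F\<bar>"

definition is_pair :: "'a set \<Rightarrow> bool" where
  "is_pair e \<longleftrightarrow> card e = 2"

definition red_pair :: "vertex set \<Rightarrow> bool" where
  "red_pair e \<longleftrightarrow> is_pair e \<and> (\<forall>v\<in>e. red v)"

definition green_pair :: "vertex set \<Rightarrow> bool" where
  "green_pair e \<longleftrightarrow> is_pair e \<and> (\<forall>v\<in>e. green v)"

definition charged_pair :: "vertex set \<Rightarrow> bool" where
  "charged_pair e \<longleftrightarrow> red_pair e \<or> green_pair e"

definition neutral_pair :: "vertex set \<Rightarrow> bool" where
  "neutral_pair e \<longleftrightarrow> is_pair e \<and> (\<exists>u\<in>e. \<exists>v\<in>e. red u \<and> green v)"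

definition in_balance :: "nat \<Rightarrow> vertex set \<Rightarrow> vertex set set \<Rightarrow> bool" where
  "in_balance n F \<E> \<longleftrightarrow>
     (\<forall>e\<in>\<E>. is_pair e \<and> e \<subseteq> hypercube n - F) \<and>
     pairwise disjnt \<E> \<and>
     red_minus_green F = int (card {e\<in>\<E>. green_pair e}) - int (card {e\<in>\<E>. red_pair e})"

definition admissible_ends :: "nat \<Rightarrow> vertex set \<Rightarrow> nat \<Rightarrow> nat \<Rightarrow> vertex set set \<Rightarrow> bool" where
  "admissible_ends n F N Q \<E> \<longleftrightarrow>
     in_balance n F \<E> \<and> card {e\<in>\<E>. neutral_pair e} = N \<and> card {e\<in>\<E>. charged_pair e} = Q"

definition freely_prescribable :: "nat \<Rightarrow> vertex set \<Rightarrow> nat \<Rightarrow> nat \<Rightarrow> bool" where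
  "freely_prescribable n F N Q \<longleftrightarrow>
     (\<exists>\<E>. admissible_ends n F N Q \<E>) \<and>
     (\<forall>\<E>. admissible_ends n F N Q \<E> \<longrightarrow>
        (\<exists>P. path_covering (hypercube n - F) adj P \<and> path_ends ` P = \<E>))"


section \<open>The number $[M,C,N,O]$\<close>

text \<open>The fourth parameter is written \<open>Q\<close> since \<open>O\<close> is reserved for relational composition.
  For \<open>M = C = N = Q = 0\<close> the library's \<open>log 2 0 = 0\<close> makes the first condition vacuous, just as
  the reading \<open>-\<infinity>\<close> does.\<close>

definition dims :: "nat \<Rightarrow> nat \<Rightarrow> nat \<Rightarrow> nat \<Rightarrow> nat set" where
  "dims M C N Q = {m.
     real m \<ge> log 2 (real (M + C + 2 * N + 2 * Q)) \<and>
     (\<forall>n\<ge>m. \<forall>F. is_fault n F \<and> mass F = M \<and> charge F = C \<longrightarrow> freely_prescribable n F N Q)}"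

definition least_dim :: "nat \<Rightarrow> nat \<Rightarrow> nat \<Rightarrow> nat \<Rightarrow> nat option" where
  "least_dim M C N Q =
     (if dims M C N Q = {} then None else Some (LEAST m. m \<in> dims M C N Q))"

end

theory Submission
  imports Defs
begin

text \<open>Split \<open>Q\<^sub>n\<^sub>+\<^sub>1\<close> along a coordinate into two plates, copies of \<open>Q\<^sub>n\<close> joined by a perfect
  matching. Since \<open>n \<ge> 4\<close>, the covering is assembled from coverings of the plates of the simpler types
  \<open>[0,0,1,0]\<close>, \<open>[1,1,0,1]\<close>, \<open>[0,0,2,0]\<close>, \<open>[0,0,0,2]\<close>, \<open>[1,1,1,1]\<close>, \<open>[2,0,1,0]\<close>; typically a Hamiltonian
  path of one plate is cut at a terminal, or at an edge avoiding two given vertices, and the loose ends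
  are joined through the other plate. No induction on the dimension is needed for \<open>[2,0,0,2]\<close> itself.
  If the two deleted vertices agree in some coordinate, split there, so that they share a plate. If they
  are antipodal, split along a coordinate separating the red pair; the only delicate position then has
  one red terminal alone with the red deleted vertex, and it needs a vertex far from both green
  terminals.
  The induction bases in dimensions 3 and 4, and an instance in \<open>Q\<^sub>4\<close> without a covering, are settled by
  exhaustive search.\<close>

section \<open>Vertex sets spanned by a path\<close>

text \<open>Colours steer every case. Partners across the matching have the same name in plate
  coordinates but opposite colours, so equally coloured vertices in different plates look oppositely
  coloured inside them. Deleting \<open>r\<close> and \<open>g\<close> from one plate leaves it
  balanced; deleting one in each plate leaves a surplus of one vertex in both. The pieces of paths
  inside a plate must match its surplus, and this decides which simpler type applies there.

  The obstacle is that loose ends must be distinct: a piece cut from a Hamiltonian path may consist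
  of a single vertex, whose two ends then collide. Auxiliary ends away from the neighbours of a
  terminal prevent this. In \<open>Q\<^sub>4\<close> the neighbourhoods of an antipodal pair exhaust
  the opposite colour, so no such end exists; dimension 5 is rescued because equally coloured
  vertices differ in at least two coordinates, which gives a second direction to split
  along.\<close>

inductive conn :: "('a \<Rightarrow> 'a \<Rightarrow> bool) \<Rightarrow> 'a \<Rightarrow> 'a \<Rightarrow> 'a set \<Rightarrow> bool" for E where
  single: "conn E v v {v}"
| step: "E u w \<Longrightarrow> conn E w v S \<Longrightarrow> u \<notin> S \<Longrightarrow> conn E u v (insert u S)"

lemma conn_ends: "conn E u v S \<Longrightarrow> u \<in> S \<and> v \<in> S"
  by (induction rule: conn.induct) auto

lemma conn_finite: "conn E u v S \<Longrightarrow> finite S"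
  by (induction rule: conn.induct) auto

lemma conn_join:
  "conn E u v S \<Longrightarrow> E v w \<Longrightarrow> conn E w z T \<Longrightarrow> S \<inter> T = {} \<Longrightarrow> conn E u z (S \<union> T)"
  by (induction rule: conn.induct) (auto intro: conn.intros)

lemma conn_rev:
  assumes "symp E" shows "conn E u v S \<Longrightarrow> conn E v u S"
proof (induction rule: conn.induct)
  case (step u w v S)
  have "conn E v u (S \<union> {u})"
    using step assms by (intro conn_join[of E v w S u u "{u}"]) (auto intro: conn.single dest: sympD)
  then show ?case by simp
qed (rule conn.single)

lemma conn_split_before:
  "conn E u v S \<Longrightarrow> x \<in> S \<Longrightarrow> x \<noteq> u \<Longrightarrow>
    \<exists>w S1 S2. S = S1 \<union> S2 \<and> S1 \<inter> S2 = {} \<and> conn E u w S1 \<and> E w x \<and> conn E x v S2"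
proof (induction rule: conn.induct)
  case (step u w v S)
  show ?case
  proof (cases "x = w")
    case True
    then show ?thesis
      using step by (intro exI[of _ u] exI[of _ "{u}"] exI[of _ S]) (auto intro: conn.single)
  next
    case False
    then obtain y S1 S2 where "S = S1 \<union> S2" "S1 \<inter> S2 = {}" "conn E w y S1" "E y x" "conn E x v S2"
      using step by auto
    then show ?thesis
      using step by (intro exI[of _ y] exI[of _ "insert u S1"] exI[of _ S2]) (auto intro: conn.step)
  qed
qed auto

lemma conn_split_after:
  "conn E u v S \<Longrightarrow> x \<in> S \<Longrightarrow> x \<noteq> v \<Longrightarrow>
    \<exists>w S1 S2. S = S1 \<union> S2 \<and> S1 \<inter> S2 = {} \<and> conn E u x S1 \<and> E x w \<and> conn E w v S2"
proof (induction rule: conn.induct)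
  case (step u w v S)
  show ?case
  proof (cases "x = u")
    case True
    then show ?thesis
      using step by (intro exI[of _ w] exI[of _ "{u}"] exI[of _ S]) (auto intro: conn.single)
  next
    case False
    then obtain y S1 S2 where "S = S1 \<union> S2" "S1 \<inter> S2 = {}" "conn E w x S1" "E x y" "conn E y v S2"
      using step by auto
    then show ?thesis
      using step by (intro exI[of _ y] exI[of _ "insert u S1"] exI[of _ S2]) (auto intro: conn.step)
  qed
qed auto

lemma split_before:
  assumes "conn E u v S" "x \<in> S" "x \<noteq> u"
  obtains w S1 S2 where "S = S1 \<union> S2" "S1 \<inter> S2 = {}" "conn E u w S1" "E w x" "conn E x v S2"
  using conn_split_before[OF assms] by (elim exE conjE)

lemma split_after:
  assumes "conn E u v S" "x \<in> S" "x \<noteq> v"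
  obtains w S1 S2 where "S = S1 \<union> S2" "S1 \<inter> S2 = {}" "conn E u x S1" "E x w" "conn E w v S2"
  using conn_split_after[OF assms] by (elim exE conjE)

lemma conn_image:
  "conn E u v S \<Longrightarrow> inj f \<Longrightarrow> (\<And>x y. E x y \<Longrightarrow> E' (f x) (f y)) \<Longrightarrow> conn E' (f u) (f v) (f ` S)"
  by (induction rule: conn.induct) (auto intro!: conn.intros dest: injD)

text \<open>A simple path uses no arc out of its last vertex or into its first. Together with
  disjointness of two pieces, this excludes every arc on which \<open>E\<close> and
  \<open>jump E b c\<close> may disagree.\<close>

lemma conn_weaken:
  assumes "conn E u v S"
    and "\<And>x y. E x y \<Longrightarrow> x \<in> S \<Longrightarrow> y \<in> S \<Longrightarrow> x \<noteq> v \<Longrightarrow> y \<noteq> u \<Longrightarrow> E' x y"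
  shows "conn E' u v S"
  using assms
proof (induction rule: conn.induct)
  case (step u w v S)
  have "conn E' w v S"
    using step.hyps(3) by (intro step.IH step.prems) auto
  then show ?case
    using step conn_ends[OF step.hyps(2)] by (intro conn.step) (auto intro!: step.prems)
qed (rule conn.single)

text \<open>The bridge to paths as lists. Elsewhere only the ends and the covered set are kept, so
  that joining paths becomes set algebra.\<close>

lemma conn_list:
  "conn E u v S \<longleftrightarrow> (\<exists>p. p \<noteq> [] \<and> hd p = u \<and> last p = v \<and> distinct p \<and> successively E p \<and> set p = S)"
proof
  show "conn E u v S \<Longrightarrow> \<exists>p. p \<noteq> [] \<and> hd p = u \<and> last p = v \<and> distinct p \<and> successively E p \<and> set p = S"
  proof (induction rule: conn.induct)
    case (single v)
    then show ?case by (intro exI[of _ "[v]"]) auto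
  next
    case (step u w v S)
    then obtain p where "p \<noteq> []" "hd p = w" "last p = v" "distinct p" "successively E p" "set p = S"
      by blast
    with step show ?case
      by (intro exI[of _ "u # p"]) (auto simp: successively_Cons)
  qed
  have "conn E (hd p) (last p) (set p)" if "p \<noteq> []" "distinct p" "successively E p" for p
    using that
  proof (induction p)
    case (Cons x p)
    then show ?case
      by (cases "p = []") (auto simp: successively_Cons intro: conn.intros)
  qed simp
  then show "\<exists>p. p \<noteq> [] \<and> hd p = u \<and> last p = v \<and> distinct p \<and> successively E p \<and> set p = S \<Longrightarrow> conn E u v S"
    by blast
qed

text \<open>Every second edge of the path starts in the colour of \<open>u\<close>, these edges are disjoint, and each
  vertex of \<open>X\<close> spoils at most one of them.\<close>

lemma conn_cut:
  fixes k :: "'a \<Rightarrow> bool"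
  assumes k: "\<And>x y. E x y \<Longrightarrow> k x \<noteq> k y"
  shows "conn E u v S \<Longrightarrow> finite X \<Longrightarrow> 2 * card X + 2 \<le> card S \<Longrightarrow>
    \<exists>x y S1 S2. S = S1 \<union> S2 \<and> S1 \<inter> S2 = {} \<and> conn E u x S1 \<and> E x y \<and> conn E y v S2 \<and>
      x \<notin> X \<and> y \<notin> X \<and> k x = k u \<and> k y \<noteq> k u"
proof (induction "card S" arbitrary: u S X rule: less_induct)
  case less
  from less.prems(1) show ?case
  proof cases
    case single
    then show ?thesis using less.prems by simp
  next
    case (step w S')
    show ?thesis
    proof (cases "u \<in> X \<or> w \<in> X")
      case False
      then show ?thesis
        using step k by (intro exI[of _ u] exI[of _ w] exI[of _ "{u}"] exI[of _ S']) (auto intro: conn.single)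
    next
      case True
      \<comment> \<open>Drop \<open>u\<close> and \<open>w\<close>: the path loses two vertices and
        \<open>X\<close> at least one, so the bound \<open>2 * card X + 2\<close> survives, and the
        next vertex \<open>z\<close> has the colour of \<open>u\<close> again.\<close>
      have cS: "card S = Suc (card S')"
        using step conn_finite[OF step(3)] by simp
      have X1: "card (X - {u, w}) < card X"
        using True less.prems(2) by (intro psubset_card_mono) auto
      from step(3) show ?thesis
      proof cases
        case single
        then show ?thesis using cS X1 less.prems(3) by simp
      next
        case (step z S'')
        note s = step
        have cS': "card S' = Suc (card S'')"
          using s conn_finite[OF s(3)] by simp
        obtain x y S1 S2 where *: "S'' = S1 \<union> S2" "S1 \<inter> S2 = {}" "conn E z x S1" "E x y" "conn E y v S2"
          "x \<notin> X - {u, w}" "y \<notin> X - {u, w}" "k x = k z" "k y \<noteq> k z"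
          using less.hyps[of S'' z "X - {u, w}"] cS cS' X1 less.prems s by auto
        have "x \<in> S''" "y \<in> S''"
          using conn_ends[OF *(3)] conn_ends[OF *(5)] *(1) by auto
        then have "x \<notin> X" "y \<notin> X"
          using * \<open>u \<notin> S'\<close> s by auto
        moreover have "k z = k u"
          using k[OF \<open>E u w\<close>] k[OF s(2)] by auto
        moreover have "conn E w x (insert w S1)"
          using conn.step[of E w z x S1] *(3) s(1,2,4) *(1) by auto
        then have "conn E u x (insert u (insert w S1))"
          using conn.step[of E u w x "insert w S1"] \<open>E u w\<close> \<open>u \<notin> S'\<close> s(1) *(1) by auto
        moreover have "S = insert u (insert w S1) \<union> S2" "insert u (insert w S1) \<inter> S2 = {}"
          using \<open>S = insert u S'\<close> \<open>u \<notin> S'\<close> s(1,4) *(1,2) by auto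
        moreover have "k x = k u" "k y \<noteq> k u"
          using *(8,9) \<open>k z = k u\<close> by simp_all
        ultimately show ?thesis
          using *(4,5) by (intro exI conjI)
      qed
    qed
  qed
qed

definition conn2 :: "('a \<Rightarrow> 'a \<Rightarrow> bool) \<Rightarrow> 'a \<Rightarrow> 'a \<Rightarrow> 'a \<Rightarrow> 'a \<Rightarrow> 'a set \<Rightarrow> bool" where
  "conn2 E a b c d V \<longleftrightarrow> (\<exists>S T. S \<union> T = V \<and> S \<inter> T = {} \<and> conn E a b S \<and> conn E c d T)"

lemma conn2I: "conn E a b S \<Longrightarrow> conn E c d T \<Longrightarrow> S \<inter> T = {} \<Longrightarrow> S \<union> T = V \<Longrightarrow> conn2 E a b c d V"
  by (auto simp: conn2_def)

lemma conn2E: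
  assumes "conn2 E a b c d V"
  obtains S T where "conn E a b S" "conn E c d T" "S \<inter> T = {}" "V = S \<union> T"
  using assms by (auto simp: conn2_def)

lemma conn2_swap: "conn2 E a b c d V \<Longrightarrow> conn2 E c d a b V"
  unfolding conn2_def by (metis Un_commute Int_commute)

lemma conn2_rev1: "symp E \<Longrightarrow> conn2 E a b c d V \<Longrightarrow> conn2 E b a c d V"
  unfolding conn2_def using conn_rev by metis

lemma conn2_rev2: "symp E \<Longrightarrow> conn2 E a b c d V \<Longrightarrow> conn2 E a b d c V"
  unfolding conn2_def using conn_rev by metis


text \<open>Two disjoint paths from \<open>a\<close> to \<open>b\<close> and from \<open>c\<close> to \<open>d\<close> are one path from \<open>a\<close> to \<open>d\<close> in the
  relation \<open>jump E b c\<close>, whose only arc out of \<open>b\<close> and only arc into \<open>c\<close> is \<open>(b, c)\<close>.\<close>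

definition jump :: "('a \<Rightarrow> 'a \<Rightarrow> bool) \<Rightarrow> 'a \<Rightarrow> 'a \<Rightarrow> 'a \<Rightarrow> 'a \<Rightarrow> bool" where
  "jump E b c x y \<longleftrightarrow> (if x = b then y = c else if y = c then False else E x y)"

text \<open>The path must leave \<open>b\<close>, as \<open>b\<close> is on it and is not its end,
  and the only way out is to \<open>c\<close>; cutting there yields both paths. So a search for one
  Hamiltonian path decides the existence of a two-path covering.\<close>

lemma conn2_jump:
  assumes "b \<in> V" "b \<noteq> d"
  shows "conn2 E a b c d V \<longleftrightarrow> conn (jump E b c) a d V"
proof
  assume "conn2 E a b c d V"
  then obtain S T where *: "conn E a b S" "conn E c d T" "S \<inter> T = {}" "V = S \<union> T"
    by (rule conn2E)
  have "c \<in> T" "b \<in> S" using * conn_ends by metis+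
  then have "conn (jump E b c) a b S" "conn (jump E b c) c d T"
    using *(3) by (auto intro!: conn_weaken[OF *(1)] conn_weaken[OF *(2)] simp: jump_def)
  then show "conn (jump E b c) a d V"
    using * conn_join[of "jump E b c" a b S c d T] by (simp add: jump_def)
next
  assume "conn (jump E b c) a d V"
  then obtain w S T where *: "V = S \<union> T" "S \<inter> T = {}" "conn (jump E b c) a b S" "jump E b c b w"
    "conn (jump E b c) w d T"
    using conn_split_after[of "jump E b c" a d V b] assms by blast
  have "w = c" using * by (simp add: jump_def)
  have "c \<in> T" "b \<in> S" using * conn_ends \<open>w = c\<close> by metis+
  then have "conn E a b S" "conn E c d T"
    using *(2) *(3,5)[unfolded \<open>w = c\<close>]
    by (auto elim!: conn_weaken simp: jump_def split: if_splits)
  then show "conn2 E a b c d V"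
    using * by (auto intro: conn2I)
qed

section \<open>Coordinates of the hypercube\<close>

lemma adj_Cons: "adj (x # u) (y # v) \<longleftrightarrow> (if x = y then adj u v else u = v)"
proof (cases "length u = length v")
  case True
  let ?D = "\<lambda>u v. {i. i < length u \<and> u ! i \<noteq> v ! i}"
  have "?D (x # u) (y # v) = (if x = y then {} else {0}) \<union> Suc ` ?D u v"
    by (auto simp: nth_Cons image_iff split: nat.splits if_splits) (metis gr0_conv_Suc neq0_conv)+
  then have "card (?D (x # u) (y # v)) = (if x = y then 0 else 1) + card (?D u v)"
    by (simp add: card_image)
  moreover have "card (?D u v) = 0 \<longleftrightarrow> u = v"
    using True by (auto simp: list_eq_iff_nth_eq)
  ultimately show ?thesis
    using True by (auto simp: adj_def)
qed (auto simp: adj_def)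

lemma adj_Nil: "\<not> adj [] v"
  by (simp add: adj_def)

lemma adj_length: "adj u v \<Longrightarrow> length u = length v"
  by (simp add: adj_def)

lemma adj_single:
  assumes "length u = length v" "i < length u" "u ! i \<noteq> v ! i" "\<And>j. j < length u \<Longrightarrow> j \<noteq> i \<Longrightarrow> u ! j = v ! j"
  shows "adj u v"
proof -
  have "{j. j < length u \<and> u ! j \<noteq> v ! j} = {i}" using assms(2-4) by auto
  then show ?thesis unfolding adj_def using assms(1) by simp
qed

lemma symp_adj: "symp adj"
proof (rule sympI)
  fix u v assume adj: "adj u v"
  then have "{i. i < length v \<and> v ! i \<noteq> u ! i} = {i. i < length u \<and> u ! i \<noteq> v ! i}"
    using adj_length by auto
  with adj show "adj v u"
    unfolding adj_def by metis
qed

lemma adj_append: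
  "length p = length p' \<Longrightarrow> adj (p @ q) (p' @ q') \<longleftrightarrow> p = p' \<and> adj q q' \<or> q = q' \<and> adj p p'"
  by (induction p p' rule: list_induct2) (auto simp: adj_Cons adj_Nil)

lemma red_Cons: "red (x # v) \<longleftrightarrow> red v \<noteq> x"
  by (auto simp: red_def)

lemma red_append: "red (u @ v) \<longleftrightarrow> red u = red v"
  by (auto simp: red_def)

lemma adj_red: "adj u v \<Longrightarrow> red u \<noteq> red v"
proof (induction u arbitrary: v)
  case (Cons x u)
  then show ?case
    using adj_length[OF Cons.prems] by (cases v) (auto simp: adj_Cons red_Cons split: if_splits)
qed (simp add: adj_Nil)

lemma green_iff: "green v \<longleftrightarrow> \<not> red v"
  by (simp add: green_def red_def)

lemma in_hypercube [simp]: "v \<in> hypercube n \<longleftrightarrow> length v = n"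
  by (simp add: hypercube_def)

lemma finite_hypercube [simp]: "finite (hypercube n)"
  and card_hypercube: "card (hypercube n) = 2 ^ n"
  using finite_lists_length_eq[of "UNIV :: bool set" n] card_lists_length_eq[of "UNIV :: bool set" n]
  by (simp_all add: hypercube_def)

text \<open>Every word of length \<open>n\<close> is the tail of exactly one vertex of the given
  colour, the first bit correcting the parity.\<close>

lemma card_colour: "card {v \<in> hypercube (Suc n). red v = k} = 2 ^ n"
proof -
  have "{v \<in> hypercube (Suc n). red v = k} = (\<lambda>v. (red v \<noteq> k) # v) ` hypercube n"
    by (auto simp: image_iff length_Suc_conv red_Cons)
  then show ?thesis
    by (simp add: card_image inj_on_def card_hypercube)
qed

lemma colour_avoiding:
  assumes "finite X" "card X < 2 ^ (n - 1)" "0 < n"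
  obtains v where "length v = n" "red v = k" "v \<notin> X"
proof -
  have "\<not> {v \<in> hypercube n. red v = k} \<subseteq> X"
    using card_colour[of "n - 1" k] assms card_mono[of X "{v \<in> hypercube n. red v = k}"] by auto
  then show ?thesis using that by auto
qed

lemma colour_avoiding3:
  assumes "3 \<le> n"
  obtains v where "length v = n" "red v = k" "v \<noteq> p" "v \<noteq> q" "v \<noteq> s"
proof -
  have "card {p, q, s} \<le> 3" by (simp add: card_insert_if)
  moreover have "(2 :: nat) ^ 2 \<le> 2 ^ (n - 1)"
    by (rule power_increasing) (use assms in auto)
  ultimately have "card {p, q, s} < 2 ^ (n - 1)" by simp
  moreover have "0 < n" using assms by simp
  ultimately obtain v where "length v = n" "red v = k" "v \<notin> {p, q, s}"
    using colour_avoiding[of "{p, q, s}" n k] by auto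
  then show thesis using that by simp
qed

lemma card_hypercube_ge: "3 \<le> n \<Longrightarrow> 8 \<le> card (hypercube n)"
  using power_increasing[of 3 n "2 :: nat"] by (simp add: card_hypercube)

lemma length_piece:
  assumes "hypercube n - X = S \<union> T" "x \<in> S \<or> x \<in> T"
  shows "length x = n"
proof -
  have "x \<in> hypercube n - X" using assms by simp
  then show ?thesis by simp
qed

lemma neighbours: "finite {v. adj u v} \<and> card {v. adj u v} \<le> length u"
proof (induction u)
  case (Cons x u)
  have sub: "{v. adj (x # u) v} \<subseteq> insert ((\<not> x) # u) ((#) x ` {v. adj u v})"
  proof
    fix v assume "v \<in> {v. adj (x # u) v}"
    then show "v \<in> insert ((\<not> x) # u) ((#) x ` {v. adj u v})"
      using adj_length[of "x # u" v] by (cases v) (auto simp: adj_Cons split: if_splits)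
  qed
  have fin: "finite (insert ((\<not> x) # u) ((#) x ` {v. adj u v}))"
    using Cons by simp
  have "card (insert ((\<not> x) # u) ((#) x ` {v. adj u v})) \<le> Suc (card {v. adj u v})"
    using Cons by (simp add: card_image card_insert_if)
  then show ?case
    using finite_subset[OF sub fin] card_mono[OF fin sub] Cons by simp
qed (simp add: adj_Nil)

text \<open>The two values of \<open>b\<close> embed \<open>Q\<^sub>n\<close> as the two plates in
  direction \<open>i\<close>; partners under the matching share the argument
  \<open>v\<close>.\<close>

definition ins :: "nat \<Rightarrow> bool \<Rightarrow> vertex \<Rightarrow> vertex" where
  "ins i b v = take i v @ b # drop i v"

lemma length_ins [simp]: "length (ins i b v) = Suc (length v)"
  by (simp add: ins_def)

lemma ins_eq_iff [simp]: "ins i b u = ins i c v \<longleftrightarrow> b = c \<and> u = v"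
proof
  assume *: "ins i b u = ins i c v"
  have "length u = length v" using arg_cong[OF *, of length] by simp
  then have "take i u = take i v" "drop i u = drop i v" "b = c"
    using * by (simp_all add: ins_def)
  then show "b = c \<and> u = v"
    by (metis append_take_drop_id)
qed simp

lemma inj_ins: "inj (ins i b)"
  by (simp add: inj_def)

lemma red_ins [simp]: "red (ins i b v) \<longleftrightarrow> red v \<noteq> b"
  using red_append[of "take i v" "drop i v"] by (auto simp: ins_def red_append red_Cons)

lemma adj_ins: "adj u v \<Longrightarrow> adj (ins i b u) (ins i b v)"
  using adj_append[of "take i u" "take i v" "drop i u" "drop i v"] adj_length[of u v]
  by (auto simp: ins_def adj_append adj_Cons)

lemma adj_ins_flip: "adj (ins i b v) (ins i (\<not> b) v)"
  by (simp add: ins_def adj_append adj_Cons)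

lemma nth_ins: "i \<le> length v \<Longrightarrow> ins i b v ! i = b"
  by (simp add: ins_def nth_append)

lemma ins_nth_other:
  assumes "i \<le> length v" "j \<le> length v" "j \<noteq> i"
  shows "ins i b v ! j = v ! (if j < i then j else j - 1)"
  using assms by (auto simp: ins_def nth_append nth_Cons' min_def)

lemma ins_cases:
  assumes "length v = Suc n" "i \<le> n"
  obtains w where "length w = n" "v = ins i (v ! i) w"
proof
  show "v = ins i (v ! i) (take i v @ drop (Suc i) v)"
    using assms id_take_nth_drop[of i v] by (simp add: ins_def)
qed (use assms in auto)

lemma ins_at:
  assumes "length v = Suc n" "i \<le> n" "v ! i = b"
  obtains w where "length w = n" "v = ins i b w"
  using ins_cases[OF assms(1,2)] unfolding assms(3) .

lemma ins_cases2 [consumes 2, case_names same opposite]: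
  assumes "length v = Suc n" "i \<le> n"
  obtains w where "length w = n" "v = ins i b w" | w where "length w = n" "v = ins i (\<not> b) w"
proof -
  obtain w where "length w = n" "v = ins i (v ! i) w"
    using ins_cases[OF assms] .
  then show ?thesis
    using that by (cases "v ! i = b") auto
qed

lemma separating_direction:
  assumes "length u = Suc n" "length v = Suc n" "u \<noteq> v"
  obtains i b u' v' where "i \<le> n" "length u' = n" "length v' = n" "u = ins i b u'" "v = ins i (\<not> b) v'"
proof -
  obtain i where i: "i \<le> n" "u ! i \<noteq> v ! i"
    using assms by (auto simp: list_eq_iff_nth_eq less_Suc_eq_le)
  obtain u' where u': "length u' = n" "u = ins i (u ! i) u'"
    using ins_cases[OF assms(1) i(1)] .
  obtain v' where v': "length v' = n" "v = ins i (v ! i) v'"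
    using ins_cases[OF assms(2) i(1)] .
  have "v ! i = (\<not> u ! i)" using i by auto
  then show ?thesis
    using that[OF i(1) u'(1) v'(1) u'(2)] v'(2) by simp
qed

lemma plates_minus:
  assumes "i \<le> n"
  shows "hypercube (Suc n) - (ins i b ` X \<union> ins i (\<not> b) ` Y) =
    ins i b ` (hypercube n - X) \<union> ins i (\<not> b) ` (hypercube n - Y)" (is "?L = ?R")
proof
  show "?L \<subseteq> ?R"
  proof
    fix v assume v: "v \<in> ?L"
    then have "length v = Suc n" by simp
    from this assms v show "v \<in> ?R"
      by (cases rule: ins_cases2[where b = b]) auto
  qed
qed auto

lemma conn_ins: "conn adj u v S \<Longrightarrow> conn adj (ins i b u) (ins i b v) (ins i b ` S)"
  by (rule conn_image[where E = adj and E' = adj and f = "ins i b", OF _ inj_ins adj_ins])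

section \<open>Exhaustive search\<close>

text \<open>Depth-first search from the current vertex \<open>x\<close> with unvisited vertices
  \<open>R\<close>. The fuel \<open>k\<close> is meant to be \<open>length R\<close>, so at
  \<open>0\<close> everything has been visited and only arrival at \<open>t\<close> remains to be
  tested.\<close>

primrec hamiltonian :: "('a \<Rightarrow> 'a \<Rightarrow> bool) \<Rightarrow> 'a \<Rightarrow> nat \<Rightarrow> 'a \<Rightarrow> 'a list \<Rightarrow> bool" where
  "hamiltonian E t 0 x R \<longleftrightarrow> x = t"
| "hamiltonian E t (Suc k) x R \<longleftrightarrow>
     list_ex (\<lambda>y. if E x y then hamiltonian E t k y (remove1 y R) else False) R"

lemma hamiltonian_iff:
  "length R = k \<Longrightarrow> distinct R \<Longrightarrow> x \<notin> set R \<Longrightarrow>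
    hamiltonian E t k x R \<longleftrightarrow> conn E x t (insert x (set R))"
proof (induction k arbitrary: x R)
  case 0
  then show ?case by (auto intro: conn.single dest: conn_ends)
next
  case (Suc k)
  have "hamiltonian E t (Suc k) x R \<longleftrightarrow> (\<exists>y\<in>set R. E x y \<and> conn E y t (set R))"
    using Suc by (auto simp: list_ex_iff length_remove1 insert_absorb)
  also have "\<dots> \<longleftrightarrow> conn E x t (insert x (set R))"
  proof
    assume "conn E x t (insert x (set R))"
    then show "\<exists>y\<in>set R. E x y \<and> conn E y t (set R)"
    proof cases
      case single
      with Suc show ?thesis by (cases R) auto
    next
      case (step w S)
      then have "S = set R" using Suc.prems by auto
      then show ?thesis using step conn_ends by metis
    qed
  qed (use Suc.prems in \<open>auto intro: conn.step\<close>)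
  finally show ?case .
qed

lemma red_code [code]: "red [] = True" "red (x # v) = (red v \<noteq> x)"
  by (simp_all add: red_def)

lemma adj_code [code]:
  "adj [] v = False" "adj (x # u) [] = False" "adj (x # u) (y # v) = (if x = y then adj u v else u = v)"
  by (simp_all add: adj_Nil adj_Cons) (simp add: adj_def)

definition cube :: "nat \<Rightarrow> vertex list" where
  "cube n = List.n_lists n [False, True]"

lemma set_cube: "set (cube n) = hypercube n"
  by (auto simp: cube_def set_n_lists)

lemma distinct_cube: "distinct (cube n)"
  by (simp add: cube_def distinct_n_lists)

lemma length_cube: "length (cube n) = 2 ^ n"
  by (simp add: cube_def length_n_lists numeral_2_eq_2)

text \<open>Guards such as \<open>length a = 3\<close> keep the simplifier from unfolding the inner quantifiers before the
  outer variables are concrete.\<close>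

lemma two_neutral_check:
  "list_all (\<lambda>a. if length a = 3 then list_all (\<lambda>b. if red a = red b \<and> a \<noteq> b then
     list_all (\<lambda>c. if red a \<noteq> red c then list_all (\<lambda>d. if red c = red d \<and> c \<noteq> d
       then hamiltonian (jump adj c b) d 7 a (remove1 a (cube 3))
       else True) (cube 3) else True) (cube 3) else True) (cube 3) else True) (cube 3)"
  by code_simp

text \<open>The condition on \<open>(p, q, x, y)\<close> keeps the positions in which every
  coordinate separating \<open>r\<close> from \<open>g\<close> has \<open>u\<close> on the side of
  \<open>r\<close> and \<open>v\<close> on the side of \<open>g\<close>; these resist splitting.
  Green \<open>r\<close> is covered by exchanging roles and reversing the path. Of 16 vertices, 13
  remain after \<open>r\<close>, \<open>g\<close> and the start.\<close>

lemma minus2_check: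
  "list_all (\<lambda>r. if red r then list_all (\<lambda>g. if \<not> red g then
     list_all (\<lambda>u. if red u \<and> u \<noteq> r then list_all (\<lambda>v. if \<not> red v \<and> v \<noteq> g \<and>
       list_all (\<lambda>(p, q, x, y). p = q \<or> x = p \<and> y = q) (zip r (zip g (zip u v)))
       then hamiltonian adj v 13 u (remove1 u (remove1 r (remove1 g (cube 4))))
       else True) (cube 4) else True) (cube 4) else True) (cube 4) else True) (cube 4)"
  by code_simp

definition far_vertices :: "vertex \<Rightarrow> vertex \<Rightarrow> vertex list" where
  "far_vertices c d =
     filter (\<lambda>y. if adj c y then False else if adj d y then False else red y \<noteq> red c) (cube (length c))"

text \<open>There are eight vertices of the opposite colour, and each of \<open>c\<close>,
  \<open>d\<close> has four of them as neighbours. At distance 2 two neighbours are common, so two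
  far vertices are left; the shared coordinate excludes the antipodal case, with none. Two are asked
  for because one may have to be avoided later.\<close>

lemma far_vertices_check:
  "list_all (\<lambda>c. if length c = 4 then list_all (\<lambda>d. if red d = red c \<and> list_ex (\<lambda>(x, y). x = y) (zip c d)
     then 1 < length (far_vertices c d) else True) (cube 4) else True) (cube 4)"
  by code_simp

lemma no_cover_check:
  "\<not> hamiltonian (jump adj [True, False, True, False] [True, False, True, True])
     [False, True, True, True] 13 [False, True, True, False]
     (remove1 [False, True, True, False] (remove1 [False, False, False, False]
       (remove1 [False, False, False, True] (cube 4))))"
  by code_simp

section \<open>Gluing paths of two plates\<close>

definition two_plates :: "nat \<Rightarrow> bool \<Rightarrow> vertex set \<Rightarrow> vertex set \<Rightarrow> vertex set" where
  "two_plates i b S T = ins i b ` S \<union> ins i (\<not> b) ` T"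

lemma two_plates_swap: "two_plates i (\<not> b) S T = two_plates i b T S"
  by (auto simp: two_plates_def)

lemma two_plates_disjoint: "S \<inter> S' = {} \<Longrightarrow> T \<inter> T' = {} \<Longrightarrow> two_plates i b S T \<inter> two_plates i b S' T' = {}"
  by (auto simp: two_plates_def)

lemma two_plates_Un: "two_plates i b S T \<union> two_plates i b S' T' = two_plates i b (S \<union> S') (T \<union> T')"
  by (auto simp: two_plates_def)

lemma hypercube_minus_plates:
  assumes "i \<le> n"
  shows "hypercube (Suc n) - two_plates i b X Y = two_plates i b (hypercube n - X) (hypercube n - Y)"
  using plates_minus[OF assms] by (simp add: two_plates_def)

text \<open>The letters in the names of the \<open>route\<close> lemmas list the plates in order of
  traversal: A has bit \<open>b\<close>, B the other. A crossing needs no renaming, since both ends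
  of a matching edge have the same plate coordinates.\<close>

lemma route_A: "conn adj u v S \<Longrightarrow> conn adj (ins i b u) (ins i b v) (two_plates i b S {})"
  using conn_ins by (simp add: two_plates_def)

lemma route_B: "conn adj u v T \<Longrightarrow> conn adj (ins i (\<not> b) u) (ins i (\<not> b) v) (two_plates i b {} T)"
  using conn_ins by (simp add: two_plates_def)

lemma route_AB:
  assumes "conn adj u x S" "conn adj x v T"
  shows "conn adj (ins i b u) (ins i (\<not> b) v) (two_plates i b S T)"
  using conn_join[OF route_A[OF assms(1), of i b] adj_ins_flip route_B[OF assms(2), of i b]]
  by (simp add: two_plates_disjoint two_plates_Un)

lemma route_BA:
  assumes "conn adj u x T" "conn adj x v S"
  shows "conn adj (ins i (\<not> b) u) (ins i b v) (two_plates i b S T)"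
  using route_AB[OF assms, of i "\<not> b"] by (simp add: two_plates_swap)

lemma route_ABA:
  assumes "conn adj u x S" "conn adj x y T" "conn adj y v S'" "S \<inter> S' = {}"
  shows "conn adj (ins i b u) (ins i b v) (two_plates i b (S \<union> S') T)"
  using conn_join[OF route_A[OF assms(1), of i b] adj_ins_flip route_BA[OF assms(2,3), of i b]] assms(4)
  by (simp add: two_plates_disjoint two_plates_Un)

lemma route_ABAB:
  assumes "conn adj u x S" "conn adj x y T" "conn adj y z S'" "conn adj z v T'" "S \<inter> S' = {}" "T \<inter> T' = {}"
  shows "conn adj (ins i b u) (ins i (\<not> b) v) (two_plates i b (S \<union> S') (T \<union> T'))"
  using conn_join[OF route_ABA[OF assms(1,2,3,5), of i b] adj_ins_flip route_B[OF assms(4), of i b]] assms(6)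
  by (simp add: two_plates_disjoint two_plates_Un)

lemma route_BAB:
  assumes "conn adj u x T" "conn adj x y S" "conn adj y v T'" "T \<inter> T' = {}"
  shows "conn adj (ins i (\<not> b) u) (ins i (\<not> b) v) (two_plates i b S (T \<union> T'))"
  using route_ABA[OF assms, of i "\<not> b"] by (simp add: two_plates_swap)

lemma route_ABABA:
  assumes "conn adj u x S" "conn adj x y T" "conn adj y z S'" "conn adj z w T'" "conn adj w v S''"
    "S \<inter> S' = {}" "T \<inter> T' = {}" "(S \<union> S') \<inter> S'' = {}"
  shows "conn adj (ins i b u) (ins i b v) (two_plates i b (S \<union> S' \<union> S'') (T \<union> T'))"
  using conn_join[OF route_ABA[OF assms(1,2,3,6), of i b] adj_ins_flip route_BA[OF assms(4,5), of i b]] assms(7,8)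
  by (simp add: two_plates_disjoint two_plates_Un)

lemma conn_plates:
  assumes "conn adj u v (two_plates i b S T)" "i \<le> n" "S = hypercube n - X" "T = hypercube n - Y"
  shows "conn adj u v (hypercube (Suc n) - two_plates i b X Y)"
  using assms by (simp add: hypercube_minus_plates)

lemma conn2_plates:
  assumes "conn adj u v (two_plates i b S T)" "conn adj w z (two_plates i b S' T')" "i \<le> n"
    "S \<inter> S' = {}" "T \<inter> T' = {}" "hypercube n - X = S \<union> S'" "hypercube n - Y = T \<union> T'"
  shows "conn2 adj u v w z (hypercube (Suc n) - two_plates i b X Y)"
  by (rule conn2I[OF assms(1,2)])
     (use assms(3-) in \<open>simp_all add: two_plates_disjoint two_plates_Un hypercube_minus_plates\<close>)

section \<open>Auxiliary path coverings\<close>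

text \<open>Type \<open>[0,0,1,0]\<close>. In a direction separating the ends, cross at any vertex
  of plate colour opposite to \<open>u'\<close>; because of the colour flip it is opposite to
  \<open>v'\<close> too.\<close>

lemma hamilton_laceable:
  "length u = n \<Longrightarrow> length v = n \<Longrightarrow> red u \<noteq> red v \<Longrightarrow> conn adj u v (hypercube n)"
proof (induction n arbitrary: u v)
  case (Suc n)
  obtain i b u' v' where *: "i \<le> n" "length u' = n" "length v' = n" "u = ins i b u'" "v = ins i (\<not> b) v'"
    by (rule separating_direction[OF Suc.prems(1,2)]) (use Suc.prems(3) in auto)
  have "\<exists>x. conn adj u' x (hypercube n) \<and> conn adj x v' (hypercube n)"
  \<comment> \<open>The plates of \<open>Q\<^sub>1\<close> are single vertices without a second
    colour, and the crossing vertex is that vertex itself.\<close>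
  proof (cases "n = 0")
    case True
    then have "u' = []" "v' = []" "hypercube n = {[]}" using * by (auto simp: hypercube_def)
    then show ?thesis by (auto intro: conn.single)
  next
    case False
    obtain x where "length x = n" "red x = (\<not> red u')"
      using colour_avoiding[of "{}" n "\<not> red u'"] False by auto
    then show ?thesis
      using Suc.IH[of u' x] Suc.IH[of x v'] * Suc.prems(3) by auto
  qed
  then show ?case
    using conn_plates[OF route_AB *(1), of u' _ "hypercube n" v' "hypercube n" "{}" "{}" b] *(4,5)
    by (auto simp: two_plates_def)
qed simp

text \<open>Type \<open>[1,1,0,1]\<close>. Split \<open>c\<close> from \<open>d\<close>, with
  \<open>r\<close> beside \<open>c\<close> up to symmetry. The plate of \<open>r\<close> is of the
  same type with an auxiliary end \<open>x\<close>, and the intact plate has a path from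
  \<open>x\<close> to \<open>d\<close>.\<close>

lemma hamilton_minus1:
  "length r = n \<Longrightarrow> length c = n \<Longrightarrow> length d = n \<Longrightarrow> red c = red d \<Longrightarrow> red r \<noteq> red c \<Longrightarrow> c \<noteq> d \<Longrightarrow>
    conn adj c d (hypercube n - {r})"
proof (induction n arbitrary: r c d)
  case (Suc n)
  have step: "conn adj (ins i b c) (ins i (\<not> b) d) (hypercube (Suc n) - {ins i b r})"
    if "i \<le> n" "length r = n" "length c = n" "length d = n" "red c \<noteq> red d" "red r \<noteq> red c" for i b r c d
  proof -
    have "\<exists>x. length x = n \<and> red x = red c \<and> conn adj c x (hypercube n - {r})"
    \<comment> \<open>In dimension 1 no second vertex has the colour of \<open>c\<close>; the plate
      without \<open>r\<close> is just \<open>c\<close>, which then serves as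
      \<open>x\<close>.\<close>
    proof (cases "n \<le> 1")
      case True
      with that have "n = 1" by (cases n) auto
      then obtain p where "c = [p]"
        using \<open>length c = n\<close> by (auto simp: length_Suc_conv)
      then have "hypercube n - {r} = {c}"
        using that \<open>n = 1\<close> by (auto simp: length_Suc_conv red_code)
      then show ?thesis using that by (auto intro: conn.single)
    next
      case False
      then have "1 < (2 :: nat) ^ (n - 1)" by (intro one_less_power) auto
      then obtain x where "length x = n" "red x = red c" "x \<noteq> c"
        using colour_avoiding[of "{c}" n "red c"] False by auto
      then show ?thesis using Suc.IH[of r c x] that by auto
    qed
    then obtain x where x: "length x = n" "red x = red c" "conn adj c x (hypercube n - {r})" by blast
    have "conn adj x d (hypercube n)"
      using x that by (intro hamilton_laceable) auto
    from conn_plates[OF route_AB[OF x(3) this, of i b] that(1), of "{r}" "{}"] show ?thesis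
      by (simp add: two_plates_def)
  qed
  obtain i b c' d' where *: "i \<le> n" "length c' = n" "length d' = n" "c = ins i b c'" "d = ins i (\<not> b) d'"
    using separating_direction[OF Suc.prems(2,3,6)] .
  from Suc.prems(1) *(1) show ?case
  proof (cases rule: ins_cases2[where b = b])
    case (same w)
    then show ?thesis using step[of i w c' d' b] * Suc.prems by auto
  next
    case (opposite w)
    then have "conn adj d c (hypercube (Suc n) - {r})"
      using step[of i w d' c' "\<not> b"] * Suc.prems by auto
    then show ?thesis by (rule conn_rev[OF symp_adj])
  qed
qed simp

text \<open>The bound 6 is \<open>2 * 2 + 2\<close>, the room that two forbidden vertices demand in
  \<open>conn_cut\<close>.\<close>

lemma cut_adj:
  assumes "conn adj u v S" "6 \<le> card S"
  obtains x y S1 S2 where "S = S1 \<union> S2" "S1 \<inter> S2 = {}" "conn adj u x S1" "adj x y" "conn adj y v S2"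
    "x \<noteq> p" "x \<noteq> q" "y \<noteq> p" "y \<noteq> q" "red x = red u" "red y \<noteq> red u"
proof -
  have "card {p, q} \<le> 2" by (simp add: card_insert_if)
  then have "2 * card {p, q} + 2 \<le> card S" using assms(2) by linarith
  from conn_cut[of adj red, OF _ assms(1) _ this] adj_red
  obtain x y S1 S2 where *: "S = S1 \<union> S2" "S1 \<inter> S2 = {}" "conn adj u x S1" "adj x y" "conn adj y v S2"
    "x \<notin> {p, q}" "y \<notin> {p, q}" "red x = red u" "red y \<noteq> red u"
    by blast
  show thesis
    by (rule that[OF *(1-5)]) (use *(6-9) in simp_all)
qed

section \<open>Two disjoint paths covering the full cube\<close>

lemma two_neutral_3:
  assumes "length a = 3" "length b = 3" "length c = 3" "length d = 3"
    "red a = red b" "red c = red d" "red a \<noteq> red c" "a \<noteq> b" "c \<noteq> d"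
  shows "conn2 adj a c b d (hypercube 3)"
proof -
  have "\<forall>a b c d. length a = 3 \<longrightarrow> length b = 3 \<longrightarrow> length c = 3 \<longrightarrow> length d = 3 \<longrightarrow> red a = red b \<and> a \<noteq> b \<longrightarrow>
    red a \<noteq> red c \<longrightarrow> red c = red d \<and> c \<noteq> d \<longrightarrow> hamiltonian (jump adj c b) d 7 a (remove1 a (cube 3))"
    using two_neutral_check unfolding list_all_iff set_cube Ball_def in_hypercube by meson
  then have "hamiltonian (jump adj c b) d 7 a (remove1 a (cube 3))"
    using assms by blast
  moreover have "insert a (set (remove1 a (cube 3))) = hypercube 3" "length (remove1 a (cube 3)) = 7"
    using assms by (auto simp: set_cube distinct_cube length_remove1 length_cube)
  ultimately have "conn (jump adj c b) a d (hypercube 3)"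
    using hamiltonian_iff[of "remove1 a (cube 3)" 7 a "jump adj c b" d] by (simp add: distinct_cube)
  then show ?thesis
    using conn2_jump[of c "hypercube 3" d adj a b] assms by simp
qed

text \<open>Type \<open>[0,0,2,0]\<close>. With \<open>a\<close> and \<open>b\<close> in different
  plates, the hard placement has \<open>d\<close> beside \<open>a\<close> and \<open>c\<close>
  beside \<open>b\<close>: a Hamiltonian path from \<open>a\<close> to \<open>d\<close> is cut at an
  edge and the induction hypothesis leads the loose ends to \<open>c\<close> and \<open>b\<close>.
  The cut needs six vertices, too many for a plate of dimension 2; hence the base in dimension
  3.\<close>

lemma two_neutral:
  "3 \<le> n \<Longrightarrow> length a = n \<Longrightarrow> length b = n \<Longrightarrow> length c = n \<Longrightarrow> length d = n \<Longrightarrow>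
    red a = red b \<Longrightarrow> red c = red d \<Longrightarrow> red a \<noteq> red c \<Longrightarrow> a \<noteq> b \<Longrightarrow> c \<noteq> d \<Longrightarrow>
    conn2 adj a c b d (hypercube n)"
proof (induction n arbitrary: a b c d rule: nat_induct_at_least)
  case base
  then show ?case by (rule two_neutral_3)
next
  case (Suc n)
  have "(2 :: nat) ^ 2 \<le> 2 ^ (n - 1)" "(2 :: nat) ^ 3 \<le> 2 ^ n"
    by (rule power_increasing; use Suc.hyps in simp)+
  then have n: "2 < (2 :: nat) ^ (n - 1)" "8 \<le> (2 :: nat) ^ n" by simp_all
  have three: "conn2 adj (ins i p a) (ins i p c) (ins i (\<not> p) e) (ins i p d) (hypercube (Suc n))"
    if "i \<le> n" "length a = n" "length e = n" "length c = n" "length d = n"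
      "red a \<noteq> red e" "red c = red d" "red a \<noteq> red c" "c \<noteq> d" for i p a e c d
  proof -
    \<comment> \<open>\<open>x\<close> replaces \<open>e\<close> in the plate of the other three
      terminals.\<close>
    obtain x where x: "length x = n" "red x = red a" "x \<noteq> a"
      using colour_avoiding[of "{a}" n "red a"] n Suc.hyps by auto
    have "conn2 adj a c x d (hypercube n)"
      using x that by (intro Suc.IH) auto
    then obtain S T where S: "conn adj a c S" "conn adj x d T" "S \<inter> T = {}" "hypercube n = S \<union> T"
      by (rule conn2E)
    have "conn adj e x (hypercube n)"
      using x that by (intro hamilton_laceable) auto
    from conn2_plates[OF route_A[OF S(1)] route_BA[OF this S(2)] that(1) S(3), of "{}" "{}" p] S(4)
    show ?thesis by (simp add: two_plates_def)
  qed
  obtain i p a' b' where *: "i \<le> n" "length a' = n" "length b' = n" "a = ins i p a'" "b = ins i (\<not> p) b'"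
    using separating_direction[OF Suc.prems(1,2,8)] .
  from Suc.prems(3) *(1) show ?case
  proof (cases rule: ins_cases2[where b = p])
    case c: (same c')
    from Suc.prems(4) *(1) show ?thesis
    proof (cases rule: ins_cases2[where b = p])
      case (same d')
      then show ?thesis
        using three[of i a' b' c' d' p] * c Suc.prems by auto
    next
      case (opposite d')
      have "conn adj a' c' (hypercube n)" "conn adj b' d' (hypercube n)"
        using * c opposite Suc.prems by (auto intro!: hamilton_laceable)
      from conn2_plates[OF route_A[OF this(1)] route_B[OF this(2)] *(1), of "{}" "{}" p] show ?thesis
        unfolding *(4,5) c(2) opposite(2) by (simp add: two_plates_def)
    qed
  next
    case c: (opposite c')
    from Suc.prems(4) *(1) show ?thesis
    proof (cases rule: ins_cases2[where b = p])
      case (same d')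
      have "conn adj a' d' (hypercube n)"
        using * c same Suc.prems by (auto intro!: hamilton_laceable)
      \<comment> \<open>To be paired with \<open>c'\<close>, the loose end \<open>x\<close> must
        have the colour opposite to \<open>a'\<close>. A cut returns the colour of the starting
        vertex, so \<open>a'\<close> is split off beforehand.\<close>
      then obtain w S where w: "adj a' w" "conn adj w d' S" "a' \<notin> S" "hypercube n = insert a' S"
        using * c same Suc.prems by (cases rule: conn.cases) auto
      have "card S + 1 = 2 ^ n"
        using arg_cong[OF w(4), of card] w(3) conn_finite[OF w(2)] by (simp add: card_hypercube)
      then have "6 \<le> card S" using n by linarith
      with w(2) obtain x y S1 S2 where cut: "S = S1 \<union> S2" "S1 \<inter> S2 = {}" "conn adj w x S1" "adj x y"
        "conn adj y d' S2" "x \<noteq> b'" "x \<noteq> c'" "y \<noteq> b'" "y \<noteq> c'" "red x = red w" "red y \<noteq> red w"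
        by (rule cut_adj[where p = b' and q = c'])
      have ax: "conn adj a' x (insert a' S1)"
        using cut(1,3) w(1,3) by (intro conn.step) auto
      have "x \<in> hypercube n" "y \<in> hypercube n"
        using conn_ends[OF cut(3)] conn_ends[OF cut(5)] unfolding w(4) cut(1) by auto
      moreover have "red w \<noteq> red a'" using adj_red[OF w(1)] by simp
      ultimately have "conn2 adj x c' b' y (hypercube n)"
        using cut(6-11) * c same Suc.prems
        by (intro Suc.IH[of x b' c' y]) auto
      then obtain T1 T2 where T: "conn adj x c' T1" "conn adj b' y T2" "T1 \<inter> T2 = {}" "hypercube n = T1 \<union> T2"
        by (rule conn2E)
      have "insert a' S1 \<inter> S2 = {}" "hypercube n - {} = insert a' S1 \<union> S2"
        using w(3,4) cut(1,2) by auto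
      from conn2_plates[OF route_AB[OF ax T(1)] route_BA[OF T(2) cut(5)] *(1) this(1) T(3) this(2), of "{}" p] T(4)
      show ?thesis
        unfolding *(4,5) c(2) same(2) by (simp add: two_plates_def)
    next
      case (opposite d')
      have "conn2 adj b d a c (hypercube (Suc n))"
        using three[of i b' a' d' c' "\<not> p"] * c opposite Suc.prems by auto
      then show ?thesis by (rule conn2_swap)
    qed
  qed
qed

text \<open>Type \<open>[0,0,0,2]\<close>, without induction: a charged pair divided between the
  plates is neutral in plate coordinates, so when both pairs are divided \<open>two_neutral\<close>
  applies one dimension lower.\<close>

lemma two_charged:
  assumes "4 \<le> n" "length a = n" "length b = n" "length c = n" "length d = n"
    "red a = red b" "red c = red d" "red a \<noteq> red c" "a \<noteq> b" "c \<noteq> d"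
  shows "conn2 adj a b c d (hypercube n)"
proof -
  define m where "m = n - 1"
  have m: "3 \<le> m" and n: "n = Suc m" using assms(1) by (auto simp: m_def)
  have three: "conn2 adj (ins i p a) (ins i (\<not> p) b) (ins i p c) (ins i p d) (hypercube n)"
    if h: "i \<le> m" "length a = m" "length b = m" "length c = m" "length d = m"
      "red a \<noteq> red b" "red c = red d" "red a \<noteq> red c" "c \<noteq> d" for i p a b c d
  proof -
    have "conn adj a c (hypercube m)" using h by (intro hamilton_laceable) auto
    moreover have "d \<in> hypercube m" "d \<noteq> a" using h by auto
    \<comment> \<open>Cut just before \<open>d\<close>: the tail already joins \<open>d\<close> to
      \<open>c\<close>, and the head ends in the colour of \<open>a\<close>, ready to cross towards
      \<open>b\<close>.\<close>
    ultimately obtain v S1 S2 where s: "hypercube m = S1 \<union> S2" "S1 \<inter> S2 = {}" "conn adj a v S1" "adj v d" "conn adj d c S2"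
      by (rule split_before)
    have "v \<in> hypercube m" using conn_ends[OF s(3)] s(1) by auto
    moreover have "red v = red a" using adj_red[OF s(4)] h by auto
    ultimately have "conn adj v b (hypercube m)"
      using h by (intro hamilton_laceable) auto
    from conn2_plates[OF route_AB[OF s(3) this] route_A[OF conn_rev[OF symp_adj s(5)]] h(1) s(2), of "{}" "{}" p] s(1)
    show ?thesis by (simp add: two_plates_def n)
  qed
  obtain i p a' b' where *: "i \<le> m" "length a' = m" "length b' = m" "a = ins i p a'" "b = ins i (\<not> p) b'"
    using separating_direction[OF assms(2,3)[unfolded n] assms(9)] .
  from assms(4)[unfolded n] *(1) show ?thesis
  proof (cases rule: ins_cases2[where b = p])
    case c: (same c')
    from assms(5)[unfolded n] *(1) show ?thesis
    proof (cases rule: ins_cases2[where b = p])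
      case (same d')
      then show ?thesis
        using three[of i a' b' c' d' p] * c assms by auto
    next
      case (opposite d')
      have "conn adj a' c' (hypercube m)"
        using * c assms by (auto intro!: hamilton_laceable)
      moreover have "6 \<le> card (hypercube m)" using card_hypercube_ge[OF m] by simp
      ultimately obtain x y S1 S2 where cut: "hypercube m = S1 \<union> S2" "S1 \<inter> S2 = {}" "conn adj a' x S1" "adj x y"
        "conn adj y c' S2" "x \<noteq> b'" "x \<noteq> d'" "y \<noteq> b'" "y \<noteq> d'" "red x = red a'" "red y \<noteq> red a'"
        by (rule cut_adj[where p = b' and q = d'])
      have "x \<in> hypercube m" "y \<in> hypercube m"
        using conn_ends[OF cut(3)] conn_ends[OF cut(5)] unfolding cut(1) by auto
      then have "conn2 adj x b' d' y (hypercube m)"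
        using cut(6-11) * c opposite assms(6-10) m by (intro two_neutral) auto
      then obtain T1 T2 where T: "conn adj x b' T1" "conn adj d' y T2" "T1 \<inter> T2 = {}" "hypercube m = T1 \<union> T2"
        by (rule conn2E)
      have "conn2 adj a b d c (hypercube n)"
        using conn2_plates[OF route_AB[OF cut(3) T(1)] route_BA[OF T(2) cut(5)] *(1) cut(2) T(3), of "{}" "{}" p]
          cut(1) T(4)
        unfolding *(4,5) c(2) opposite(2) n by (simp add: two_plates_def)
      then show ?thesis by (rule conn2_rev2[OF symp_adj])
    qed
  next
    case c: (opposite c')
    from assms(5)[unfolded n] *(1) show ?thesis
    proof (cases rule: ins_cases2[where b = p])
      case (same d')
      have "conn adj a' d' (hypercube m)"
        using * same assms by (auto intro!: hamilton_laceable)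
      moreover have "6 \<le> card (hypercube m)" using card_hypercube_ge[OF m] by simp
      ultimately obtain x y S1 S2 where cut: "hypercube m = S1 \<union> S2" "S1 \<inter> S2 = {}" "conn adj a' x S1" "adj x y"
        "conn adj y d' S2" "x \<noteq> b'" "x \<noteq> c'" "y \<noteq> b'" "y \<noteq> c'" "red x = red a'" "red y \<noteq> red a'"
        by (rule cut_adj[where p = b' and q = c'])
      have "x \<in> hypercube m" "y \<in> hypercube m"
        using conn_ends[OF cut(3)] conn_ends[OF cut(5)] unfolding cut(1) by auto
      then have "conn2 adj x b' c' y (hypercube m)"
        using cut(6-11) * c same assms(6-10) m by (intro two_neutral) auto
      then obtain T1 T2 where T: "conn adj x b' T1" "conn adj c' y T2" "T1 \<inter> T2 = {}" "hypercube m = T1 \<union> T2"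
        by (rule conn2E)
      show ?thesis
        using conn2_plates[OF route_AB[OF cut(3) T(1)] route_BA[OF T(2) cut(5)] *(1) cut(2) T(3), of "{}" "{}" p]
          cut(1) T(4)
        unfolding *(4,5) c(2) same(2) n by (simp add: two_plates_def)
    next
      case (opposite d')
      have "conn2 adj b a c d (hypercube n)"
        using three[of i b' a' c' d' "\<not> p"] * c opposite assms by auto
      then show ?thesis by (rule conn2_rev1[OF symp_adj])
    qed
  qed
qed

text \<open>Type \<open>[1,1,1,1]\<close>. Split \<open>d\<close> from \<open>e\<close>, with
  \<open>d\<close> beside \<open>r\<close> up to exchange, and take a Hamiltonian path from
  \<open>d\<close> in that plate without \<open>r\<close>. It is cut just before \<open>a\<close> if
  \<open>a\<close> lies on it, at an edge avoiding the names of \<open>a\<close> and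
  \<open>e\<close> if only \<open>c\<close> does, and not at all if neither does.\<close>

lemma minus1_neutral_charged:
  assumes "4 \<le> n" "length r = n" "length a = n" "length c = n" "length d = n" "length e = n"
    "red a = red r" "red c \<noteq> red r" "red d = red c" "red e = red c" "a \<noteq> r" "c \<noteq> d" "c \<noteq> e" "d \<noteq> e"
  shows "conn2 adj a c d e (hypercube n - {r})"
proof -
  define m where "m = n - 1"
  have m: "3 \<le> m" and n: "n = Suc m" using assms(1) by (auto simp: m_def)
  have step: "conn2 adj a c (ins i p d) (ins i (\<not> p) e) (hypercube n - {ins i p r})"
    if h: "i \<le> m" "length r = m" "length d = m" "length e = m" "red d \<noteq> red r" "red d \<noteq> red e"
      "red (ins i p d) = red c" "a \<noteq> ins i p r" "c \<noteq> ins i p d" "c \<noteq> ins i (\<not> p) e" for i p r d e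
  proof -
    note ac = assms(3,4)[unfolded n]
    have X: "{ins i p r} = two_plates i p {r} {}" by (simp add: two_plates_def)
    from ac(1) h(1) show ?thesis
    proof (cases rule: ins_cases2[where b = p])
      case a: (same a')
      from ac(2) h(1) show ?thesis
      proof (cases rule: ins_cases2[where b = p])
        case c: (same c')
        have "conn adj d c' (hypercube m - {r})"
          using a c h assms by (intro hamilton_minus1) auto
        moreover have "a' \<in> hypercube m - {r}" "a' \<noteq> d" using a h assms(7,8) by auto
        ultimately obtain w S1 S2 where s: "hypercube m - {r} = S1 \<union> S2" "S1 \<inter> S2 = {}" "conn adj d w S1"
          "adj w a'" "conn adj a' c' S2"
          by (rule split_before)
        have "length w = m" using length_piece[OF s(1)] conn_ends[OF s(3)] by simp
        then have "conn adj w e (hypercube m)"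
          using adj_red[OF s(4)] a h assms(7,8) by (intro hamilton_laceable) auto
        from conn2_plates[OF route_A[OF s(5)] route_AB[OF s(3) this] h(1), of "{r}" "{}" p] s(1,2)
        show ?thesis unfolding a(2) c(2) X n by auto
      next
        case c: (opposite c')
        obtain x where x: "length x = m" "red x = red d" "x \<noteq> d"
          using colour_avoiding3[OF m] by metis
        have "conn adj d x (hypercube m - {r})"
          using x h by (intro hamilton_minus1) auto
        moreover have "a' \<in> hypercube m - {r}" "a' \<noteq> d" using a h assms(7,8) by auto
        ultimately obtain w S1 S2 where s: "hypercube m - {r} = S1 \<union> S2" "S1 \<inter> S2 = {}" "conn adj d w S1"
          "adj w a'" "conn adj a' x S2"
          by (rule split_before)
        have "length w = m" using length_piece[OF s(1)] conn_ends[OF s(3)] by simp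
        moreover have "w \<noteq> x" using conn_ends[OF s(3)] conn_ends[OF s(5)] s(2) by auto
        ultimately have "conn2 adj x c' w e (hypercube m)"
          using adj_red[OF s(4)] m x a c h assms(7,8) by (intro two_neutral) auto
        then obtain T1 T2 where T: "conn adj x c' T1" "conn adj w e T2" "T1 \<inter> T2 = {}" "hypercube m = T1 \<union> T2"
          by (rule conn2E)
        from conn2_plates[OF route_AB[OF s(5) T(1)] route_AB[OF s(3) T(2)] h(1), of "{r}" "{}" p] s(1,2) T(3,4)
        show ?thesis unfolding a(2) c(2) X n by auto
      qed
    next
      case a: (opposite a')
      from ac(2) h(1) show ?thesis
      proof (cases rule: ins_cases2[where b = p])
        case c: (same c')
        have "conn adj d c' (hypercube m - {r})"
          using a c h assms by (intro hamilton_minus1) auto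
        moreover have "6 \<le> card (hypercube m - {r})" using card_hypercube_ge[OF m] h by simp
        ultimately obtain x y S1 S2 where cut: "hypercube m - {r} = S1 \<union> S2" "S1 \<inter> S2 = {}" "conn adj d x S1"
          "adj x y" "conn adj y c' S2" "x \<noteq> a'" "x \<noteq> e" "y \<noteq> a'" "y \<noteq> e" "red x = red d" "red y \<noteq> red d"
          by (rule cut_adj[where p = a' and q = e])
        have "length x = m" "length y = m"
          using length_piece[OF cut(1)] conn_ends[OF cut(3)] conn_ends[OF cut(5)] by simp_all
        then have "conn2 adj a' y x e (hypercube m)"
          using cut(6-11) m a c h assms(7,8) by (intro two_neutral) auto
        then obtain T1 T2 where T: "conn adj a' y T1" "conn adj x e T2" "T1 \<inter> T2 = {}" "hypercube m = T1 \<union> T2"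
          by (rule conn2E)
        from conn2_plates[OF route_BA[OF T(1) cut(5)] route_AB[OF cut(3) T(2)] h(1), of "{r}" "{}" p] cut(1,2) T(3,4)
        show ?thesis unfolding a(2) c(2) X n by auto
      next
        case c: (opposite c')
        obtain x where x: "length x = m" "red x = red d" "x \<noteq> d" "x \<noteq> a'"
          using colour_avoiding3[OF m] by metis
        have dx: "conn adj d x (hypercube m - {r})"
          using x h by (intro hamilton_minus1) auto
        have "conn2 adj a' c' x e (hypercube m)"
          using m x a c h assms(7,8) by (intro two_neutral) auto
        then obtain T1 T2 where T: "conn adj a' c' T1" "conn adj x e T2" "T1 \<inter> T2 = {}" "hypercube m = T1 \<union> T2"
          by (rule conn2E)
        from conn2_plates[OF route_B[OF T(1)] route_AB[OF dx T(2)] h(1), of "{r}" "{}" p] T(3,4)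
        show ?thesis unfolding a(2) c(2) X n by auto
      qed
    qed
  qed
  obtain i p d' e' where *: "i \<le> m" "length d' = m" "length e' = m" "d = ins i p d'" "e = ins i (\<not> p) e'"
    using separating_direction[OF assms(5,6)[unfolded n] assms(14)] .
  from assms(2)[unfolded n] *(1) show ?thesis
  proof (cases rule: ins_cases2[where b = p])
    case (same r')
    have "red d' \<noteq> red r'" "red d' \<noteq> red e'" "red (ins i p d') = red c"
      using assms(8-10) unfolding same(2) *(4,5) red_ins by auto
    then have "conn2 adj a c (ins i p d') (ins i (\<not> p) e') (hypercube n - {ins i p r'})"
      using same *(1-3) assms(11-13) unfolding *(4,5) by (intro step) simp_all
    then show ?thesis by (simp add: same(2) *(4,5))
  next
    case (opposite r')
    have "red e' \<noteq> red r'" "red e' \<noteq> red d'" "red (ins i (\<not> p) e') = red c"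
      using assms(8-10) unfolding opposite(2) *(4,5) red_ins by auto
    then have "conn2 adj a c (ins i (\<not> p) e') (ins i (\<not> \<not> p) d') (hypercube n - {ins i (\<not> p) r'})"
      using opposite *(1-3) assms(11-13) unfolding *(4,5) by (intro step) simp_all
    then have "conn2 adj a c e d (hypercube n - {r})" by (simp add: opposite(2) *(4,5))
    then show ?thesis by (rule conn2_rev2[OF symp_adj])
  qed
qed

section \<open>Hamiltonian paths avoiding two vertices of opposite colours\<close>

lemma hamilton_minus2_4:
  assumes "length r = 4" "length g = 4" "length u = 4" "length v = 4"
    "red r" "\<not> red g" "red u" "\<not> red v" "u \<noteq> r" "v \<noteq> g"
    "\<And>i. i < 4 \<Longrightarrow> r ! i \<noteq> g ! i \<Longrightarrow> u ! i = r ! i \<and> v ! i = g ! i"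
  shows "conn adj u v (hypercube 4 - {r, g})"
proof -
  let ?R = "remove1 u (remove1 r (remove1 g (cube 4)))"
  have "list_all (\<lambda>(p, q, x, y). p = q \<or> x = p \<and> y = q) (zip r (zip g (zip u v)))"
    using assms(1-4,11) by (auto simp: list_all_length)
  then have "hamiltonian adj v 13 u ?R"
    using minus2_check assms unfolding list_all_iff[of _ "cube 4"] set_cube Ball_def in_hypercube by meson
  moreover have "r \<noteq> g" "u \<noteq> g" using assms by auto
  moreover have "set ?R = hypercube 4 - {r, g} - {u}"
    by (auto simp: set_cube distinct_cube)
  moreover have "length ?R = 13"
    using assms \<open>r \<noteq> g\<close> \<open>u \<noteq> g\<close> by (simp add: length_remove1 length_cube set_cube distinct_cube)
  moreover have "insert u (hypercube 4 - {r, g} - {u}) = hypercube 4 - {r, g}"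
    using assms \<open>u \<noteq> g\<close> by auto
  ultimately show ?thesis
    using hamiltonian_iff[of ?R 13 u adj v] by (simp add: distinct_cube)
qed

text \<open>Type \<open>[2,0,1,0]\<close>. In a direction separating \<open>r\<close> from
  \<open>g\<close>, both plates fall to \<open>hamilton_minus1\<close> unless \<open>u\<close> lies
  with \<open>r\<close> and \<open>v\<close> with \<open>g\<close>: a Hamiltonian path of the plate
  without \<open>r\<close> has both ends in the colour opposite to \<open>r\<close>, so it cannot
  start in \<open>u\<close>. If every such direction is blocked, one separating \<open>u\<close>
  from \<open>r\<close> keeps \<open>r\<close> and \<open>g\<close> together, and the induction
  hypothesis handles their plate.\<close>

lemma hamilton_minus2:
  "4 \<le> n \<Longrightarrow> length r = n \<Longrightarrow> length g = n \<Longrightarrow> length u = n \<Longrightarrow> length v = n \<Longrightarrow>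
    red u = red r \<Longrightarrow> red v = red g \<Longrightarrow> red r \<noteq> red g \<Longrightarrow> u \<noteq> r \<Longrightarrow> v \<noteq> g \<Longrightarrow>
    conn adj u v (hypercube n - {r, g})"
proof (induction n arbitrary: r g u v rule: less_induct)
  case (less n)
  define m where "m = n - 1"
  have m: "3 \<le> m" and n: "n = Suc m" using less.prems(1) by (auto simp: m_def)
  note len = less.prems(2-5)[unfolded n]
  have both: "conn adj (ins i p u) (ins i p v) (hypercube n - {ins i p r, ins i (\<not> p) g})"
    if h: "i \<le> m" "length r = m" "length g = m" "length u = m" "length v = m"
      "red u = red r" "red g = red r" "red v \<noteq> red r" "u \<noteq> r" for i p r g u v
  proof -
    have X: "{ins i p r, ins i (\<not> p) g} = two_plates i p {r} {g}" by (auto simp: two_plates_def)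
    obtain y where y: "length y = m" "red y = red v" "y \<noteq> v"
      using colour_avoiding3[OF m] by metis
    have "conn adj v y (hypercube m - {r})"
      using y h by (intro hamilton_minus1) auto
    moreover have "u \<in> hypercube m - {r}" "u \<noteq> v" using h by auto
    \<comment> \<open>Opening the path just before \<open>u\<close> leaves the loose ends
      \<open>w\<close> and \<open>y\<close>, which are joined through the plate of
      \<open>g\<close>.\<close>
    ultimately obtain w S1 S2 where s: "hypercube m - {r} = S1 \<union> S2" "S1 \<inter> S2 = {}" "conn adj v w S1"
      "adj w u" "conn adj u y S2"
      by (rule split_before)
    have "length w = m" using length_piece[OF s(1)] conn_ends[OF s(3)] by simp
    moreover have "w \<noteq> y" using conn_ends[OF s(3)] conn_ends[OF s(5)] s(2) by auto
    ultimately have "conn adj y w (hypercube m - {g})"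
      using adj_red[OF s(4)] y h by (intro hamilton_minus1) auto
    from conn_plates[OF route_ABA[OF s(5) this conn_rev[OF symp_adj s(3)]] h(1), of "{r}" "{g}" p] s(1,2)
    show ?thesis unfolding X n by (simp add: Un_commute Int_commute)
  qed
  have cross: "conn adj (ins i (\<not> p) u) (ins i p v) (hypercube n - {ins i p r, ins i (\<not> p) g})"
    if h: "i \<le> m" "length r = m" "length g = m" "length u = m" "length v = m"
      "red u \<noteq> red r" "red g = red r" "red v \<noteq> red r" for i p r g u v
  proof -
    have X: "{ins i p r, ins i (\<not> p) g} = two_plates i p {r} {g}" by (auto simp: two_plates_def)
    obtain x where x: "length x = m" "red x = red v" "x \<noteq> v" "x \<noteq> u"
      using colour_avoiding3[OF m] by metis
    have "conn adj u x (hypercube m - {g})" "conn adj x v (hypercube m - {r})"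
      using x h by (auto intro!: hamilton_minus1)
    from conn_plates[OF route_BA[OF this] h(1), of "{r}" "{g}" p]
    show ?thesis unfolding X n by simp
  qed
  show ?case
  proof (cases "\<exists>i\<le>m. r ! i \<noteq> g ! i \<and> \<not> (u ! i = r ! i \<and> v ! i = g ! i)")
    case True
    then obtain i where i: "i \<le> m" "r ! i \<noteq> g ! i" "u ! i \<noteq> r ! i \<or> v ! i \<noteq> g ! i" by blast
    define p where "p = r ! i"
    obtain r' where r: "length r' = m" "r = ins i p r'" using ins_at[OF len(1) i(1) p_def[symmetric]] .
    have "g ! i = (\<not> p)" using i(2) p_def by auto
    obtain g' where g: "length g' = m" "g = ins i (\<not> p) g'" using ins_at[OF len(2) i(1) \<open>g ! i = (\<not> p)\<close>] .
    obtain u' where u: "length u' = m" "u = ins i (u ! i) u'" using ins_cases[OF len(3) i(1)] .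
    obtain v' where v: "length v' = m" "v = ins i (v ! i) v'" using ins_cases[OF len(4) i(1)] .
    have rg: "red g' = red r'" using less.prems(8) unfolding r(2) g(2) red_ins by auto
    consider "u ! i = p" "v ! i = p" | "u ! i = (\<not> p)" "v ! i = p" | "u ! i = (\<not> p)" "v ! i = (\<not> p)"
      using i \<open>g ! i = (\<not> p)\<close> p_def by auto
    then show ?thesis
    proof cases
      case 1
      note uv = u(2)[unfolded 1] v(2)[unfolded 1]
      have "red u' = red r'" "red v' \<noteq> red r'" "u' \<noteq> r'"
        using less.prems(6-9) unfolding uv r(2) g(2) red_ins by auto
      then show ?thesis
        unfolding uv r(2) g(2) using i(1) r(1) g(1) u(1) v(1) rg by (intro both)
    next
      case 2
      note uv = u(2)[unfolded 2] v(2)[unfolded 2]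
      have "red u' \<noteq> red r'" "red v' \<noteq> red r'"
        using less.prems(6-8) unfolding uv r(2) g(2) red_ins by auto
      then show ?thesis
        unfolding uv r(2) g(2) using i(1) r(1) g(1) u(1) v(1) rg by (intro cross)
    next
      case 3
      note uv = u(2)[unfolded 3] v(2)[unfolded 3]
      have "red v' = red g'" "red u' \<noteq> red g'" "v' \<noteq> g'" "red r' = red g'"
        using less.prems(6-10) rg unfolding uv r(2) g(2) red_ins by auto
      then have "conn adj (ins i (\<not> p) v') (ins i (\<not> p) u') (hypercube n - {ins i (\<not> p) g', ins i (\<not> \<not> p) r'})"
        using i(1) r(1) g(1) u(1) v(1) by (intro both)
      from conn_rev[OF symp_adj this] show ?thesis
        unfolding uv r(2) g(2) by (simp add: insert_commute)
    qed
  next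
    case False
    then have blocked: "r ! i \<noteq> g ! i \<Longrightarrow> u ! i = r ! i \<and> v ! i = g ! i" if "i \<le> m" for i
      using that by blast
    show ?thesis
    proof (cases "m = 3")
      case True
      then have n4: "n = 4" using n by simp
      show ?thesis
      proof (cases "red r")
        case True
        show ?thesis
          unfolding n4 by (rule hamilton_minus2_4) (use True less.prems n4 blocked \<open>m = 3\<close> in auto)
      next
        case False
        have "conn adj v u (hypercube 4 - {g, r})"
          by (rule hamilton_minus2_4) (use False less.prems n4 blocked \<open>m = 3\<close> in auto)
        then have "conn adj u v (hypercube 4 - {g, r})"
          by (rule conn_rev[OF symp_adj])
        then show ?thesis
          unfolding n4 by (simp add: insert_commute)
      qed
    next
      case False
      with m have m4: "4 \<le> m" by simp
      obtain i p u' r' where *: "i \<le> m" "length u' = m" "length r' = m" "u = ins i p u'" "r = ins i (\<not> p) r'"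
        using separating_direction[OF len(3,1) less.prems(9)] .
      \<comment> \<open>Were \<open>g\<close> to differ from \<open>r\<close> here,
        \<open>blocked\<close> would put \<open>u\<close> on the side of \<open>r\<close>, against
        the choice of \<open>i\<close>.\<close>
      have "g ! i = (\<not> p)"
        using blocked[OF *(1)] * by (auto simp: nth_ins)
      obtain g' where g: "length g' = m" "g = ins i (\<not> p) g'"
        using ins_at[OF len(2) *(1) \<open>g ! i = (\<not> p)\<close>] .
      have X: "{r, g} = two_plates i p {} {r', g'}"
        by (auto simp: two_plates_def *(5) g(2))
      have col: "red u' \<noteq> red r'" "red g' \<noteq> red r'"
        using less.prems(6,8) unfolding *(4,5) g(2) red_ins by auto
      from len(4) *(1) show ?thesis
      proof (cases rule: ins_cases2[where b = p])
        case (same v')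
        have "red v' \<noteq> red u'"
          using less.prems(6-8) unfolding *(4,5) same(2) g(2) red_ins by auto
        then have "conn adj u' v' (hypercube m)"
          using * same by (intro hamilton_laceable) auto
        moreover have "6 \<le> card (hypercube m)" using card_hypercube_ge[OF m] by simp
        ultimately obtain x y S1 S2 where cut: "hypercube m = S1 \<union> S2" "S1 \<inter> S2 = {}" "conn adj u' x S1" "adj x y"
          "conn adj y v' S2" "x \<noteq> r'" "x \<noteq> g'" "y \<noteq> r'" "y \<noteq> g'" "red x = red u'" "red y \<noteq> red u'"
          by (rule cut_adj[where p = r' and q = g'])
        have "length x = m" "length y = m"
          using length_piece[of m "{}", simplified, OF cut(1)] conn_ends[OF cut(3)] conn_ends[OF cut(5)] by simp_all
        then have "conn adj y x (hypercube m - {r', g'})"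
          using cut(6-11) col *(3) g(1) m4 n by (intro less.IH) auto
        from conn_plates[OF route_ABA[OF cut(3) conn_rev[OF symp_adj this] cut(5,2)] *(1), of "{}" "{r', g'}" p] cut(1)
        show ?thesis unfolding X n *(4) same(2) by simp
      next
        case (opposite v')
        have "red v' \<noteq> red r'" "v' \<noteq> g'"
          using less.prems(7,8,10) unfolding *(5) opposite(2) g(2) red_ins by auto
        obtain x where x: "length x = m" "red x = red r'" "x \<noteq> r'"
          using colour_avoiding3[OF m] by metis
        have "conn adj u' x (hypercube m)"
          using x * col by (intro hamilton_laceable) auto
        moreover have "conn adj x v' (hypercube m - {r', g'})"
          using x *(3) g(1) opposite(1) col m4 n \<open>red v' \<noteq> red r'\<close> \<open>v' \<noteq> g'\<close> by (intro less.IH) auto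
        ultimately show ?thesis
          using conn_plates[OF route_AB *(1), of u' x "hypercube m" v' "hypercube m - {r', g'}" "{}" "{r', g'}" p]
          unfolding X n *(4) opposite(2) by simp
      qed
    qed
  qed
qed

lemma hamilton_minus2':
  assumes "4 \<le> n" "length r = n" "length g = n" "length u = n" "length v = n"
    "red r \<noteq> red g" "red u \<noteq> red v" "u \<noteq> r" "u \<noteq> g" "v \<noteq> r" "v \<noteq> g"
  shows "conn adj u v (hypercube n - {r, g})"
proof (cases "red u = red r")
  case True
  then show ?thesis using assms by (intro hamilton_minus2) auto
next
  case False
  then have "conn adj u v (hypercube n - {g, r})"
    using assms by (intro hamilton_minus2) auto
  then show ?thesis by (simp add: insert_commute)
qed

section \<open>Two charged paths avoiding a neutral pair\<close>

text \<open>Only relative colours are fixed, so exchanging \<open>(r, a, b)\<close> with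
  \<open>(g, c, d)\<close> is a symmetry, besides the reversal of either pair.\<close>

definition terminals :: "nat \<Rightarrow> vertex \<Rightarrow> vertex \<Rightarrow> vertex \<Rightarrow> vertex \<Rightarrow> vertex \<Rightarrow> vertex \<Rightarrow> bool" where
  "terminals n r g a b c d \<longleftrightarrow>
     length r = n \<and> length g = n \<and> length a = n \<and> length b = n \<and> length c = n \<and> length d = n \<and>
     red g \<noteq> red r \<and> red a = red r \<and> red b = red r \<and> red c = red g \<and> red d = red g \<and>
     a \<noteq> b \<and> c \<noteq> d \<and> a \<noteq> r \<and> b \<noteq> r \<and> c \<noteq> g \<and> d \<noteq> g"

definition linked :: "nat \<Rightarrow> vertex \<Rightarrow> vertex \<Rightarrow> vertex \<Rightarrow> vertex \<Rightarrow> vertex \<Rightarrow> vertex \<Rightarrow> bool" where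
  "linked n r g a b c d \<longleftrightarrow> conn2 adj a b c d (hypercube n - {r, g})"

lemma terminals_rev: "terminals n r g a b c d \<Longrightarrow> terminals n r g b a c d"
  and terminals_swap: "terminals n r g a b c d \<Longrightarrow> terminals n g r c d a b"
  by (auto simp: terminals_def)

lemma linked_rev: "linked n r g a b c d \<Longrightarrow> linked n r g b a c d"
  unfolding linked_def by (rule conn2_rev1[OF symp_adj])

lemma linked_swap: "linked n r g a b c d \<Longrightarrow> linked n g r c d a b"
  unfolding linked_def insert_commute[of g] by (rule conn2_swap)

lemma linked_rev2: "linked n r g a b c d \<Longrightarrow> linked n r g a b d c"
  unfolding linked_def by (rule conn2_rev2[OF symp_adj])

lemma terminals_rev2: "terminals n r g a b c d \<Longrightarrow> terminals n r g a b d c"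
  by (auto simp: terminals_def)

subsection \<open>Both deleted vertices in one plate\<close>

text \<open>The digits in the names \<open>linked_wxyz\<close> and \<open>linked_apart_wxyz\<close> tell for \<open>a\<close>, \<open>b\<close>, \<open>c\<close>, \<open>d\<close>, in
  this order, whether the vertex lies in the plate of \<open>r\<close>.\<close>

lemma linked_0000:
  assumes "4 \<le> m" "i \<le> m"
    "terminals (Suc m) (ins i p r) (ins i p g) (ins i (\<not> p) a) (ins i (\<not> p) b) (ins i (\<not> p) c) (ins i (\<not> p) d)"
  shows "linked (Suc m) (ins i p r) (ins i p g) (ins i (\<not> p) a) (ins i (\<not> p) b) (ins i (\<not> p) c) (ins i (\<not> p) d)"
proof -
  have t: "length r = m" "length g = m" "length a = m" "length b = m" "length c = m" "length d = m"
    "red g \<noteq> red r" "red b = red a" "red c \<noteq> red a" "red d = red c" "a \<noteq> b" "c \<noteq> d"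
    using assms(3) unfolding terminals_def by auto
  have X: "{ins i p r, ins i p g} = two_plates i p {r, g} {}"
    by (simp add: two_plates_def)
  \<comment> \<open>The plate of \<open>r\<close> and \<open>g\<close> holds no terminal and is
    inserted into one edge of a path covering the other plate, at an edge avoiding their
    names.\<close>
  have detour: "conn2 adj (ins i (\<not> p) a) (ins i (\<not> p) b) (ins i (\<not> p) c) (ins i (\<not> p) d)
      (hypercube (Suc m) - {ins i p r, ins i p g})"
    if h: "conn adj a b S" "conn adj c d T" "S \<inter> T = {}" "hypercube m = S \<union> T" "6 \<le> card S" for a b c d S T
  proof -
    obtain x y S1 S2 where cut: "S = S1 \<union> S2" "S1 \<inter> S2 = {}" "conn adj a x S1" "adj x y"
      "conn adj y b S2" "x \<noteq> r" "x \<noteq> g" "y \<noteq> r" "y \<noteq> g" "red x = red a" "red y \<noteq> red a"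
      by (rule cut_adj[OF h(1,5), where p = r and q = g])
    have "length x = m" "length y = m"
      using length_piece[of m "{}" S T] h(4) conn_ends[OF cut(3)] conn_ends[OF cut(5)] unfolding cut(1) by auto
    then have "conn adj x y (hypercube m - {r, g})"
      using cut(6-11) t(1,2,7) assms(1) by (intro hamilton_minus2') auto
    from conn2_plates[OF route_BAB[OF cut(3) this cut(5,2)] route_B[OF h(2)] assms(2), of "{r, g}" "{}" p] h(3,4) cut(1)
    show ?thesis unfolding X by simp
  qed
  have "conn2 adj a b c d (hypercube m)"
    using t assms(1) by (intro two_charged) auto
  then obtain S T where S: "conn adj a b S" "conn adj c d T" "S \<inter> T = {}" "hypercube m = S \<union> T"
    by (rule conn2E)
  \<comment> \<open>Two paths share at least 16 vertices, so one of them has the six that the cut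
    needs.\<close>
  have "(2 :: nat) ^ 4 \<le> 2 ^ m" by (rule power_increasing) (use assms(1) in auto)
  then have "16 \<le> card S + card T"
    using card_hypercube[of m] card_Un_disjoint[OF conn_finite[OF S(1)] conn_finite[OF S(2)] S(3)] S(4) by simp
  then consider "6 \<le> card S" | "6 \<le> card T" by linarith
  then show ?thesis
  proof cases
    case 1
    then show ?thesis unfolding linked_def using detour S by blast
  next
    case 2
    have "T \<inter> S = {}" "hypercube m = T \<union> S" using S by auto
    from conn2_swap[OF detour[OF S(2,1) this 2]] show ?thesis unfolding linked_def .
  qed
qed

text \<open>The path from \<open>a\<close> sweeps its plate up to an auxiliary \<open>y\<close>,
  which takes the place of \<open>a\<close> in the other plate.\<close>

lemma linked_1000:
  assumes "4 \<le> m" "i \<le> m"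
    "terminals (Suc m) (ins i p r) (ins i p g) (ins i p a) (ins i (\<not> p) b) (ins i (\<not> p) c) (ins i (\<not> p) d)"
  shows "linked (Suc m) (ins i p r) (ins i p g) (ins i p a) (ins i (\<not> p) b) (ins i (\<not> p) c) (ins i (\<not> p) d)"
proof -
  have t: "length r = m" "length g = m" "length a = m" "length b = m" "length c = m" "length d = m"
    "red g \<noteq> red r" "red a = red r" "red b \<noteq> red r" "red c = red r" "red d = red r" "c \<noteq> d" "a \<noteq> r"
    using assms(3) unfolding terminals_def by auto
  have X: "{ins i p r, ins i p g} = two_plates i p {r, g} {}"
    by (simp add: two_plates_def)
  obtain y where y: "length y = m" "red y = red g" "y \<noteq> g" "y \<noteq> b"
    using colour_avoiding3[of m "red g" g b b] assms(1) by auto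
  have ay: "conn adj a y (hypercube m - {r, g})"
    using y t assms(1) by (intro hamilton_minus2) auto
  have "conn2 adj y b c d (hypercube m)"
    using y t assms(1) by (intro two_charged) auto
  then obtain S T where S: "conn adj y b S" "conn adj c d T" "S \<inter> T = {}" "hypercube m = S \<union> T"
    by (rule conn2E)
  from conn2_plates[OF route_AB[OF ay S(1)] route_B[OF S(2)] assms(2), of "{r, g}" "{}" p] S(3,4)
  show ?thesis unfolding linked_def X by simp
qed

lemma linked_1010:
  assumes "4 \<le> m" "i \<le> m"
    "terminals (Suc m) (ins i p r) (ins i p g) (ins i p a) (ins i (\<not> p) b) (ins i p c) (ins i (\<not> p) d)"
  shows "linked (Suc m) (ins i p r) (ins i p g) (ins i p a) (ins i (\<not> p) b) (ins i p c) (ins i (\<not> p) d)"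
proof -
  have t: "length r = m" "length g = m" "length a = m" "length b = m" "length c = m" "length d = m"
    "red g \<noteq> red r" "red a = red r" "red b \<noteq> red r" "red c \<noteq> red r" "red d = red r" "c \<noteq> g" "a \<noteq> r"
    using assms(3) unfolding terminals_def by auto
  have X: "{ins i p r, ins i p g} = two_plates i p {r, g} {}"
    by (simp add: two_plates_def)
  have "conn adj a c (hypercube m - {r, g})"
    using t assms(1) by (intro hamilton_minus2) auto
  moreover have "6 \<le> card (hypercube m - {r, g})"
  proof -
    have "r \<noteq> g" using t(7) by auto
    then have "card (hypercube m - {r, g}) = card (hypercube m) - 2"
      using t(1,2) by (subst card_Diff_subset) auto
    then show ?thesis using card_hypercube_ge[of m] assms(1) by linarith
  qed
  ultimately obtain x y S1 S2 where cut: "hypercube m - {r, g} = S1 \<union> S2" "S1 \<inter> S2 = {}" "conn adj a x S1" "adj x y"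
    "conn adj y c S2" "x \<noteq> b" "x \<noteq> d" "y \<noteq> b" "y \<noteq> d" "red x = red a" "red y \<noteq> red a"
    by (rule cut_adj[where p = b and q = d])
  have "length x = m" "length y = m"
    using length_piece[OF cut(1)] conn_ends[OF cut(3)] conn_ends[OF cut(5)] by simp_all
  then have "conn2 adj x b d y (hypercube m)"
    using cut(6-11) t assms(1) by (intro two_neutral) auto
  then obtain T1 T2 where T: "conn adj x b T1" "conn adj d y T2" "T1 \<inter> T2 = {}" "hypercube m = T1 \<union> T2"
    by (rule conn2E)
  from conn2_plates[OF route_AB[OF cut(3) T(1)] route_BA[OF T(2) cut(5)] assms(2), of "{r, g}" "{}" p] cut(1,2) T(3,4)
  show ?thesis by - (rule linked_rev2, simp add: linked_def X)
qed

text \<open>A Hamiltonian path from \<open>a\<close> runs past \<open>b\<close> to an auxiliary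
  \<open>y\<close>; the stretch from \<open>w\<close> to \<open>y\<close> behind \<open>b\<close> is
  given to the path between \<open>c\<close> and \<open>d\<close>, attached at both ends through the
  other plate. This needs \<open>w \<noteq> y\<close>, so \<open>y\<close> must not be a neighbour
  of \<open>b\<close>.\<close>

lemma linked_1100:
  assumes "4 \<le> m" "i \<le> m"
    "terminals (Suc m) (ins i p r) (ins i p g) (ins i p a) (ins i p b) (ins i (\<not> p) c) (ins i (\<not> p) d)"
  shows "linked (Suc m) (ins i p r) (ins i p g) (ins i p a) (ins i p b) (ins i (\<not> p) c) (ins i (\<not> p) d)"
proof -
  have t: "length r = m" "length g = m" "length a = m" "length b = m" "length c = m" "length d = m"
    "red g \<noteq> red r" "red a = red r" "red b = red r" "red c = red r" "red d = red r" "c \<noteq> d" "a \<noteq> r" "b \<noteq> r" "a \<noteq> b"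
    using assms(3) unfolding terminals_def by auto
  have X: "{ins i p r, ins i p g} = two_plates i p {r, g} {}"
    by (simp add: two_plates_def)
  \<comment> \<open>Forbidden are \<open>g\<close> and at most \<open>m\<close> neighbours of
    \<open>b\<close>; from \<open>m = 4\<close> on, \<open>m + 1\<close> is less than the size of a
    colour class.\<close>
  have "finite (insert g {y. adj b y})" "card (insert g {y. adj b y}) \<le> Suc m"
    using neighbours[of b] t(4) by (auto simp: card_insert_if)
  moreover have "Suc m < 2 ^ (m - 1)"
    using assms(1)
  proof (induction m rule: nat_induct_at_least)
    case (Suc k)
    then show ?case by (cases k) auto
  qed simp
  ultimately obtain y where y: "length y = m" "red y = red g" "y \<noteq> g" "\<not> adj b y"
    using colour_avoiding[of "insert g {y. adj b y}" m "red g"] assms(1) by auto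
  have "conn adj a y (hypercube m - {r, g})"
    using y t assms(1) by (intro hamilton_minus2) auto
  moreover have "b \<in> hypercube m - {r, g}" "b \<noteq> y" using t y by auto
  ultimately obtain w S1 S2 where s: "hypercube m - {r, g} = S1 \<union> S2" "S1 \<inter> S2 = {}" "conn adj a b S1" "adj b w"
    "conn adj w y S2"
    by (rule split_after)
  have "length w = m" using length_piece[OF s(1)] conn_ends[OF s(5)] by simp
  moreover have "w \<noteq> y" using s(4) y(4) by auto
  ultimately have "conn2 adj w c y d (hypercube m)"
    using adj_red[OF s(4)] y t assms(1) by (intro two_neutral) auto
  then obtain T1 T2 where T: "conn adj w c T1" "conn adj y d T2" "T1 \<inter> T2 = {}" "hypercube m = T1 \<union> T2"
    by (rule conn2E)
  from conn2_plates[OF route_A[OF s(3)] route_BAB[OF conn_rev[OF symp_adj T(1)] s(5) T(2,3)] assms(2), of "{r, g}" "{}" p]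
    s(1,2) T(4)
  show ?thesis unfolding X linked_def by simp
qed

lemma linked_1110:
  assumes "4 \<le> m" "i \<le> m"
    "terminals (Suc m) (ins i p r) (ins i p g) (ins i p a) (ins i p b) (ins i p c) (ins i (\<not> p) d)"
  shows "linked (Suc m) (ins i p r) (ins i p g) (ins i p a) (ins i p b) (ins i p c) (ins i (\<not> p) d)"
proof -
  have t: "length r = m" "length g = m" "length a = m" "length b = m" "length c = m" "length d = m"
    "red g \<noteq> red r" "red a = red r" "red b = red r" "red c \<noteq> red r" "red d = red r" "c \<noteq> g" "a \<noteq> r" "b \<noteq> r"
    using assms(3) unfolding terminals_def by auto
  have X: "{ins i p r, ins i p g} = two_plates i p {r, g} {}"
    by (simp add: two_plates_def)
  have "conn adj a c (hypercube m - {r, g})"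
    using t assms(1) by (intro hamilton_minus2) auto
  moreover have "b \<in> hypercube m - {r, g}" "b \<noteq> c" using t by auto
  ultimately obtain w S1 S2 where s: "hypercube m - {r, g} = S1 \<union> S2" "S1 \<inter> S2 = {}" "conn adj a b S1" "adj b w"
    "conn adj w c S2"
    by (rule split_after)
  have "length w = m" using length_piece[OF s(1)] conn_ends[OF s(5)] by simp
  then have "conn adj d w (hypercube m)"
    using adj_red[OF s(4)] t by (intro hamilton_laceable) auto
  from conn2_plates[OF route_A[OF s(3)] route_BA[OF this s(5)] assms(2), of "{r, g}" "{}" p] s(1,2)
  show ?thesis by - (rule linked_rev2, simp add: linked_def X)
qed

lemma linked_1111:
  assumes "4 \<le> m" "i \<le> m"
    "terminals (Suc m) (ins i p r) (ins i p g) (ins i p a) (ins i p b) (ins i p c) (ins i p d)"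
  shows "linked (Suc m) (ins i p r) (ins i p g) (ins i p a) (ins i p b) (ins i p c) (ins i p d)"
proof -
  have t: "length r = m" "length g = m" "length a = m" "length b = m" "length c = m" "length d = m"
    "red g \<noteq> red r" "red a = red r" "red b = red r" "red c \<noteq> red r" "red d \<noteq> red r" "c \<noteq> d"
    "c \<noteq> g" "d \<noteq> g" "a \<noteq> r" "b \<noteq> r" "a \<noteq> b"
    using assms(3) unfolding terminals_def by auto
  have X: "{ins i p r, ins i p g} = two_plates i p {r, g} {}"
    by (simp add: two_plates_def)
  have "conn adj a c (hypercube m - {r, g})"
    using t assms(1) by (intro hamilton_minus2) auto
  moreover have "b \<in> hypercube m - {r, g}" "b \<noteq> c" using t by auto
  ultimately obtain w S1 S2 where s: "hypercube m - {r, g} = S1 \<union> S2" "S1 \<inter> S2 = {}" "conn adj a b S1" "adj b w"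
    "conn adj w c S2"
    by (rule split_after)
  have w: "length w = m" using length_piece[OF s(1)] conn_ends[OF s(5)] by simp
  have "d \<in> hypercube m - {r, g}" using t by auto
  then consider "d \<in> S1" | "d \<in> S2" "d = w" | "d \<in> S2" "d \<noteq> w" unfolding s(1) by blast
  then show ?thesis
  proof cases
    \<comment> \<open>Order \<open>a..v d..q b w..c\<close>: joining \<open>v\<close> to
      \<open>b\<close> and \<open>q\<close> to \<open>w\<close> through the other plate gives
      \<open>a..v b\<close> and \<open>d..q w..c\<close>.\<close>
    case 1
    moreover have "d \<noteq> a" "b \<noteq> d" using t by auto
    ultimately obtain v V1 V2 where v: "S1 = V1 \<union> V2" "V1 \<inter> V2 = {}" "conn adj a v V1" "adj v d" "conn adj d b V2"
      using split_before[OF s(3)] by metis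
    obtain q P1 P2 where q: "V2 = P1 \<union> P2" "P1 \<inter> P2 = {}" "conn adj d q P1" "adj q b" "conn adj b b P2"
      using split_before[OF v(5) _ \<open>b \<noteq> d\<close>] conn_ends[OF v(5)] by metis
    have "length v = m" "length q = m" "v \<noteq> b" "q \<noteq> w"
      using length_piece[OF s(1)] conn_ends[OF v(3)] conn_ends[OF v(5)] conn_ends[OF q(3)] conn_ends[OF s(5)]
        v(1,2) q(1) s(2) by auto
    then have "conn2 adj v b q w (hypercube m)"
      using adj_red[OF v(4)] adj_red[OF q(4)] adj_red[OF s(4)] w t assms(1) by (intro two_charged) auto
    then obtain T1 T2 where T: "conn adj v b T1" "conn adj q w T2" "T1 \<inter> T2 = {}" "hypercube m = T1 \<union> T2"
      by (rule conn2E)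
    have "V1 \<inter> P2 = {}" "P1 \<inter> S2 = {}" "(V1 \<union> P2) \<inter> (P1 \<union> S2) = {}"
      "hypercube m - {r, g} = (V1 \<union> P2) \<union> (P1 \<union> S2)"
      using s(1,2) v(1,2) q(1,2) by auto
    from conn2_plates[OF route_ABA[OF v(3) T(1) q(5) this(1)] route_ABA[OF q(3) T(2) s(5) this(2)] assms(2) this(3) T(3) this(4), of "{}" p] T(4)
    show ?thesis by - (rule linked_rev2, simp add: linked_def X)
  next
    \<comment> \<open>\<open>w..c\<close> already is the second path; the other plate is inserted
      into the last edge of the first.\<close>
    case 2
    have "b \<in> S1" "b \<noteq> a" using conn_ends[OF s(3)] t by auto
    with s(3) obtain q P1 P2 where q: "S1 = P1 \<union> P2" "P1 \<inter> P2 = {}" "conn adj a q P1" "adj q b" "conn adj b b P2"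
      by (rule split_before)
    have "length q = m" using length_piece[OF s(1)] conn_ends[OF q(3)] q(1) by simp
    then have "conn adj q b (hypercube m)"
      using adj_red[OF q(4)] t by (intro hamilton_laceable) auto
    from conn2_plates[OF route_ABA[OF q(3) this q(5,2)] route_A[OF s(5)] assms(2), of "{r, g}" "{}" p] s(1,2) q(1)
    show ?thesis unfolding \<open>d = w\<close> by - (rule linked_rev2, simp add: linked_def X)
  next
    \<comment> \<open>Order \<open>a..q b w..v d..c\<close>: \<open>d..c\<close> is finished, and
      the first path runs the stretch behind \<open>b\<close> backwards, as
      \<open>a..q v..w b\<close>.\<close>
    case 3
    obtain v V1 V2 where v: "S2 = V1 \<union> V2" "V1 \<inter> V2 = {}" "conn adj w v V1" "adj v d" "conn adj d c V2"
      using split_before[OF s(5) 3] .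
    have "b \<in> S1" "b \<noteq> a" using conn_ends[OF s(3)] t by auto
    with s(3) obtain q P1 P2 where q: "S1 = P1 \<union> P2" "P1 \<inter> P2 = {}" "conn adj a q P1" "adj q b" "conn adj b b P2"
      by (rule split_before)
    have "length v = m" "length q = m" "v \<noteq> b" "q \<noteq> w"
      using length_piece[OF s(1)] conn_ends[OF v(3)] conn_ends[OF q(3)] conn_ends[OF s(5)] conn_ends[OF s(3)]
        v(1,2) q(1) s(2) by auto
    then have "conn2 adj q v w b (hypercube m)"
      using adj_red[OF v(4)] adj_red[OF q(4)] adj_red[OF s(4)] w t assms(1) by (intro two_neutral) auto
    then obtain T1 T2 where T: "conn adj q v T1" "conn adj w b T2" "T1 \<inter> T2 = {}" "hypercube m = T1 \<union> T2"
      by (rule conn2E)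
    have "P1 \<inter> V1 = {}" "(P1 \<union> V1) \<inter> P2 = {}" "(P1 \<union> V1 \<union> P2) \<inter> V2 = {}"
      "hypercube m - {r, g} = (P1 \<union> V1 \<union> P2) \<union> V2"
      using s(1,2) v(1,2) q(1,2) by auto
    from conn2_plates[OF route_ABABA[OF q(3) T(1) conn_rev[OF symp_adj v(3)] T(2) q(5) this(1) T(3) this(2)]
        route_A[OF v(5)] assms(2) this(3) _ this(4), of "{}" p] T(4)
    show ?thesis by - (rule linked_rev2, simp add: linked_def X)
  qed
qed

text \<open>Up to reversing and exchanging the pairs, a placement is given by how many terminals of
  each pair lie with \<open>r\<close> and \<open>g\<close>; the order conditions pick one
  representative for each of the six classes.\<close>

lemma linked_sorted:
  assumes "4 \<le> m" "i \<le> m" "terminals (Suc m) r g a b c d" "r ! i = g ! i"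
    "b ! i = r ! i \<Longrightarrow> a ! i = r ! i" "d ! i = r ! i \<Longrightarrow> c ! i = r ! i"
    "c ! i = r ! i \<Longrightarrow> a ! i = r ! i" "d ! i = r ! i \<Longrightarrow> b ! i = r ! i"
  shows "linked (Suc m) r g a b c d"
proof -
  define p where "p = r ! i"
  have len: "length r = Suc m" "length g = Suc m" "length a = Suc m" "length b = Suc m" "length c = Suc m" "length d = Suc m"
    using assms(3) by (simp_all add: terminals_def)
  obtain r' where r: "length r' = m" "r = ins i p r'" using ins_at[OF len(1) assms(2) p_def[symmetric]] .
  have "g ! i = p" using assms(4) p_def by simp
  then obtain g' where g: "length g' = m" "g = ins i p g'" by (rule ins_at[OF len(2) assms(2)])
  obtain a' where a: "length a' = m" "a = ins i (a ! i) a'" using ins_cases[OF len(3) assms(2)] .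
  obtain b' where b: "length b' = m" "b = ins i (b ! i) b'" using ins_cases[OF len(4) assms(2)] .
  obtain c' where c: "length c' = m" "c = ins i (c ! i) c'" using ins_cases[OF len(5) assms(2)] .
  obtain d' where d: "length d' = m" "d = ins i (d ! i) d'" using ins_cases[OF len(6) assms(2)] .
  note mono = assms(5-8)[folded p_def]
  consider "a ! i = (\<not> p)" "b ! i = (\<not> p)" "c ! i = (\<not> p)" "d ! i = (\<not> p)"
    | "a ! i = p" "b ! i = (\<not> p)" "c ! i = (\<not> p)" "d ! i = (\<not> p)"
    | "a ! i = p" "b ! i = (\<not> p)" "c ! i = p" "d ! i = (\<not> p)"
    | "a ! i = p" "b ! i = p" "c ! i = (\<not> p)" "d ! i = (\<not> p)"
    | "a ! i = p" "b ! i = p" "c ! i = p" "d ! i = (\<not> p)"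
    | "a ! i = p" "b ! i = p" "c ! i = p" "d ! i = p"
    using mono by argo
  then show ?thesis
  proof cases
    case 1
    note e = a(2)[unfolded 1] b(2)[unfolded 1] c(2)[unfolded 1] d(2)[unfolded 1]
    show ?thesis using linked_0000[OF assms(1,2), of p r' g' a' b' c' d'] assms(3) unfolding r(2)[symmetric] g(2)[symmetric] e[symmetric] .
  next
    case 2
    note e = a(2)[unfolded 2] b(2)[unfolded 2] c(2)[unfolded 2] d(2)[unfolded 2]
    show ?thesis using linked_1000[OF assms(1,2), of p r' g' a' b' c' d'] assms(3) unfolding r(2)[symmetric] g(2)[symmetric] e[symmetric] .
  next
    case 3
    note e = a(2)[unfolded 3] b(2)[unfolded 3] c(2)[unfolded 3] d(2)[unfolded 3]
    show ?thesis using linked_1010[OF assms(1,2), of p r' g' a' b' c' d'] assms(3) unfolding r(2)[symmetric] g(2)[symmetric] e[symmetric] .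
  next
    case 4
    note e = a(2)[unfolded 4] b(2)[unfolded 4] c(2)[unfolded 4] d(2)[unfolded 4]
    show ?thesis using linked_1100[OF assms(1,2), of p r' g' a' b' c' d'] assms(3) unfolding r(2)[symmetric] g(2)[symmetric] e[symmetric] .
  next
    case 5
    note e = a(2)[unfolded 5] b(2)[unfolded 5] c(2)[unfolded 5] d(2)[unfolded 5]
    show ?thesis using linked_1110[OF assms(1,2), of p r' g' a' b' c' d'] assms(3) unfolding r(2)[symmetric] g(2)[symmetric] e[symmetric] .
  next
    case 6
    note e = a(2)[unfolded 6] b(2)[unfolded 6] c(2)[unfolded 6] d(2)[unfolded 6]
    show ?thesis using linked_1111[OF assms(1,2), of p r' g' a' b' c' d'] assms(3) unfolding r(2)[symmetric] g(2)[symmetric] e[symmetric] .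
  qed
qed

lemma linked_same_plate:
  assumes "4 \<le> m" "i \<le> m" "terminals (Suc m) r g a b c d" "r ! i = g ! i"
  shows "linked (Suc m) r g a b c d"
proof -
  have half: "linked (Suc m) r g a b c d"
    if "terminals (Suc m) r g a b c d" "b ! i = r ! i \<Longrightarrow> a ! i = r ! i" "d ! i = r ! i \<Longrightarrow> c ! i = r ! i" for a b c d
  proof (cases "(c ! i = r ! i \<longrightarrow> a ! i = r ! i) \<and> (d ! i = r ! i \<longrightarrow> b ! i = r ! i)")
    case True
    then show ?thesis using linked_sorted[OF assms(1,2) that(1) assms(4) that(2,3)] by blast
  next
    case False
    have "linked (Suc m) g r c d a b"
      by (rule linked_sorted[OF assms(1,2) terminals_swap[OF that(1)] assms(4)[symmetric]])
        (use False that(2,3) assms(4) in argo)+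
    then show ?thesis by (rule linked_swap)
  qed
  have rest: "linked (Suc m) r g a b c d"
    if "terminals (Suc m) r g a b c d" "b ! i = r ! i \<Longrightarrow> a ! i = r ! i" for a b c d
  proof (cases "d ! i = r ! i \<longrightarrow> c ! i = r ! i")
    case True
    then show ?thesis using half[OF that] by blast
  next
    case False
    then show ?thesis using linked_rev2[OF half[OF terminals_rev2[OF that(1)] that(2)]] by blast
  qed
  show ?thesis
  proof (cases "b ! i = r ! i \<longrightarrow> a ! i = r ! i")
    case True
    then show ?thesis using rest[OF assms(3)] by blast
  next
    case False
    then show ?thesis using linked_rev[OF rest[OF terminals_rev[OF assms(3)]]] by blast
  qed
qed

subsection \<open>The deleted vertices in different plates\<close>

text \<open>Lying apart, \<open>r\<close> and \<open>g\<close> have equal plate colours. The three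
  terminals beside \<open>r\<close> form with a crossing vertex \<open>x\<close> an instance of type
  \<open>[1,1,1,1]\<close>; the other plate only needs a charged path from \<open>x\<close> to
  \<open>b\<close>.\<close>

lemma linked_apart_1011:
  assumes "4 \<le> m" "i \<le> m"
    "terminals (Suc m) (ins i p r) (ins i (\<not> p) g) (ins i p a) (ins i (\<not> p) b) (ins i p c) (ins i p d)"
  shows "linked (Suc m) (ins i p r) (ins i (\<not> p) g) (ins i p a) (ins i (\<not> p) b) (ins i p c) (ins i p d)"
proof -
  have t: "length r = m" "length g = m" "length a = m" "length b = m" "length c = m" "length d = m"
    "red g = red r" "red a = red r" "red b \<noteq> red r" "red c \<noteq> red r" "red d = red c" "c \<noteq> d" "a \<noteq> r"
    using assms(3) unfolding terminals_def by auto
  have X: "{ins i p r, ins i (\<not> p) g} = two_plates i p {r} {g}"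
    by (auto simp: two_plates_def)
  obtain x where x: "length x = m" "red x = red b" "x \<noteq> c" "x \<noteq> d" "x \<noteq> b"
    using colour_avoiding3[of m "red b" c d b] assms(1) by auto
  have "conn2 adj a x c d (hypercube m - {r})"
    using x t assms(1) by (intro minus1_neutral_charged) auto
  then obtain S T where S: "conn adj a x S" "conn adj c d T" "S \<inter> T = {}" "hypercube m - {r} = S \<union> T"
    by (rule conn2E)
  have "conn adj x b (hypercube m - {g})"
    using x t by (intro hamilton_minus1) auto
  from conn2_plates[OF route_AB[OF S(1) this] route_A[OF S(2)] assms(2) S(3) _ S(4), of "{g}" p]
  show ?thesis unfolding X linked_def by simp
qed

text \<open>Both plates are of type \<open>[1,1,1,1]\<close> with the same crossing vertices. Beside
  \<open>r\<close>, the pair \<open>a\<close>, \<open>x\<close> is neutral and \<open>c\<close>,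
  \<open>y\<close> charged; beside \<open>g\<close>, the pair \<open>d\<close>, \<open>y\<close> is
  neutral and \<open>x\<close>, \<open>b\<close> charged.\<close>

lemma linked_apart_1010:
  assumes "4 \<le> m" "i \<le> m"
    "terminals (Suc m) (ins i p r) (ins i (\<not> p) g) (ins i p a) (ins i (\<not> p) b) (ins i p c) (ins i (\<not> p) d)"
  shows "linked (Suc m) (ins i p r) (ins i (\<not> p) g) (ins i p a) (ins i (\<not> p) b) (ins i p c) (ins i (\<not> p) d)"
proof -
  have t: "length r = m" "length g = m" "length a = m" "length b = m" "length c = m" "length d = m"
    "red g = red r" "red a = red r" "red b \<noteq> red r" "red c \<noteq> red r" "red d = red r" "a \<noteq> r" "d \<noteq> g"
    using assms(3) unfolding terminals_def by auto
  have X: "{ins i p r, ins i (\<not> p) g} = two_plates i p {r} {g}"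
    by (auto simp: two_plates_def)
  obtain x where x: "length x = m" "red x = red b" "x \<noteq> c" "x \<noteq> b"
    using colour_avoiding3[of m "red b" c b b] assms(1) by auto
  obtain y where y: "length y = m" "red y = red b" "y \<noteq> c" "y \<noteq> b" "y \<noteq> x"
    using colour_avoiding3[of m "red b" c b x] assms(1) by auto
  have "conn2 adj a x c y (hypercube m - {r})"
    using x y t assms(1) by (intro minus1_neutral_charged) auto
  then obtain S1 S2 where S: "conn adj a x S1" "conn adj c y S2" "S1 \<inter> S2 = {}" "hypercube m - {r} = S1 \<union> S2"
    by (rule conn2E)
  have "conn2 adj d y x b (hypercube m - {g})"
    using x y t assms(1) by (intro minus1_neutral_charged) auto
  then obtain T1 T2 where T: "conn adj d y T1" "conn adj x b T2" "T1 \<inter> T2 = {}" "hypercube m - {g} = T1 \<union> T2"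
    by (rule conn2E)
  have "T2 \<inter> T1 = {}" "hypercube m - {g} = T2 \<union> T1" using T by auto
  from conn2_plates[OF route_AB[OF S(1) T(2)] route_BA[OF T(1) conn_rev[OF symp_adj S(2)]] assms(2) S(3) this(1) S(4) this(2), of p]
  show ?thesis by - (rule linked_rev2, simp add: linked_def X)
qed

text \<open>A Hamiltonian path from \<open>b\<close> to \<open>y\<close> beside \<open>g\<close>
  reads \<open>b..u c..d w..y\<close>, and \<open>c..d\<close> is one of the paths wanted. The other
  goes from \<open>a\<close> to \<open>y\<close> beside \<open>r\<close>, back along
  \<open>y..w\<close>, from \<open>w\<close> to \<open>u\<close> beside \<open>r\<close>, and home
  along \<open>u..b\<close>. This is type \<open>[1,1,1,1]\<close> provided
  \<open>w \<noteq> y\<close>, so \<open>y\<close> must avoid the neighbours of whichever of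
  \<open>c\<close> and \<open>d\<close> comes last.\<close>

lemma linked_apart_1000:
  assumes "4 \<le> m" "i \<le> m"
    "terminals (Suc m) (ins i p r) (ins i (\<not> p) g) (ins i p a) (ins i (\<not> p) b) (ins i (\<not> p) c) (ins i (\<not> p) d)"
    "length y = m" "red y = red b" "y \<noteq> b" "\<not> adj c y" "\<not> adj d y"
  shows "linked (Suc m) (ins i p r) (ins i (\<not> p) g) (ins i p a) (ins i (\<not> p) b) (ins i (\<not> p) c) (ins i (\<not> p) d)"
proof -
  have t: "length r = m" "length g = m" "length a = m" "length b = m" "length c = m" "length d = m"
    "red g = red r" "red a = red r" "red b \<noteq> red r" "red c = red r" "red d = red r" "a \<noteq> r" "c \<noteq> g" "d \<noteq> g" "c \<noteq> d"
    using assms(3) unfolding terminals_def by auto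
  have X: "{ins i p r, ins i (\<not> p) g} = two_plates i p {r} {g}"
    by (auto simp: two_plates_def)
  have along: "linked (Suc m) (ins i p r) (ins i (\<not> p) g) (ins i p a) (ins i (\<not> p) b) (ins i (\<not> p) c) (ins i (\<not> p) d)"
    if h: "hypercube m - {g} = S1 \<union> S2" "S1 \<inter> S2 = {}" "conn adj b u S1" "adj u c" "conn adj c y S2" "d \<in> S2"
      "length d = m" "red c = red r" "red d = red r" "\<not> adj d y" for c d u S1 S2
  proof -
    have "d \<noteq> y" using h(9) assms(5) t(9) by auto
    with h(5,6) obtain w V1 V2 where v: "S2 = V1 \<union> V2" "V1 \<inter> V2 = {}" "conn adj c d V1" "adj d w" "conn adj w y V2"
      by (rule split_after)
    have "length u = m" "length w = m" "u \<noteq> w" "u \<noteq> y" "w \<noteq> y"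
      using length_piece[OF h(1)] conn_ends[OF h(3)] conn_ends[OF h(5)] conn_ends[OF v(5)] v(1,4) h(2,10) by auto
    then have "conn2 adj a y w u (hypercube m - {r})"
      using adj_red[OF h(4)] adj_red[OF v(4)] h(8,9) t assms(1,4,5) by (intro minus1_neutral_charged) auto
    then obtain T1 T2 where T: "conn adj a y T1" "conn adj w u T2" "T1 \<inter> T2 = {}" "hypercube m - {r} = T1 \<union> T2"
      by (rule conn2E)
    have "V2 \<inter> S1 = {}" "(V2 \<union> S1) \<inter> V1 = {}" "hypercube m - {g} = V2 \<union> S1 \<union> V1"
      using h(1,2) v(1,2) by auto
    from conn2_plates[OF route_ABAB[OF T(1) conn_rev[OF symp_adj v(5)] T(2) conn_rev[OF symp_adj h(3)] T(3) this(1)]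
        route_B[OF v(3)] assms(2) _ this(2) _ this(3), of "{r}" p] T(4)
    show ?thesis unfolding X linked_def by simp
  qed
  have "conn adj b y (hypercube m - {g})"
    using t assms(4-6) by (intro hamilton_minus1) auto
  moreover have c: "c \<in> hypercube m - {g}" "c \<noteq> b" using t by auto
  ultimately obtain u S1 S2 where s: "hypercube m - {g} = S1 \<union> S2" "S1 \<inter> S2 = {}" "conn adj b u S1" "adj u c" "conn adj c y S2"
    by (rule split_before)
  show ?thesis
  proof (cases "d \<in> S2")
    case True
    show ?thesis by (rule along[OF s True]) (use t assms(8) in simp_all)
  next
    case False
    have "d \<in> hypercube m - {g}" "d \<noteq> b" using t by auto
    then have "d \<in> S1" "d \<noteq> b" using False unfolding s(1) by simp_all
    with s(3) obtain w V1 V2 where v: "S1 = V1 \<union> V2" "V1 \<inter> V2 = {}" "conn adj b w V1" "adj w d" "conn adj d u V2"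
      by (rule split_before)
    have "V2 \<inter> S2 = {}" using s(2) v(1) by auto
    from conn_join[OF v(5) s(4,5) this] have "conn adj d y (V2 \<union> S2)" .
    moreover have "hypercube m - {g} = V1 \<union> (V2 \<union> S2)" "V1 \<inter> (V2 \<union> S2) = {}" "c \<in> V2 \<union> S2"
      using s(1,2) v(1,2) conn_ends[OF s(5)] by auto
    ultimately have "linked (Suc m) (ins i p r) (ins i (\<not> p) g) (ins i p a) (ins i (\<not> p) b) (ins i (\<not> p) d) (ins i (\<not> p) c)"
      using along[of V1 "V2 \<union> S2" w d c] v(3,4) t assms(7) by blast
    then show ?thesis by (rule linked_rev2)
  qed
qed

text \<open>From \<open>m = 5\<close> on counting suffices: at most \<open>2 * m + 1\<close>
  forbidden vertices against \<open>2 ^ (m - 1)\<close> of the colour. For \<open>m = 4\<close> the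
  count is 9 against 8, so the search takes over, under the shared coordinate.\<close>

lemma far_vertex:
  assumes "4 \<le> m" "length c = m" "length d = m" "red d = red c" "m = 4 \<Longrightarrow> \<exists>k<m. c ! k = d ! k"
  obtains y where "length y = m" "red y \<noteq> red c" "y \<noteq> b" "\<not> adj c y" "\<not> adj d y"
proof (cases "m = 4")
  case True
  obtain k where "k < 4" "c ! k = d ! k" using assms(5) True by auto
  then have "list_ex (\<lambda>(x, y). x = y) (zip c d)"
    using assms(2,3) True by (auto simp: list_ex_length)
  moreover have "length c = 4" "length d = 4" using assms(2,3) True by simp_all
  ultimately have "1 < length (far_vertices c d)"
    using far_vertices_check assms(4) unfolding list_all_iff set_cube Ball_def in_hypercube by meson
  moreover have "distinct (far_vertices c d)" by (simp add: far_vertices_def distinct_cube)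
  ultimately have "\<not> set (far_vertices c d) \<subseteq> {b}"
    using card_mono[of "{b}" "set (far_vertices c d)"] by (auto simp: distinct_card)
  then obtain y where "y \<in> set (far_vertices c d)" "y \<noteq> b" by blast
  then show thesis using that assms(2) by (auto simp: far_vertices_def set_cube split: if_splits)
next
  case False
  then have m: "5 \<le> m" using assms(1) by simp
  let ?X = "insert b ({y. adj c y} \<union> {y. adj d y})"
  have "card ?X \<le> Suc (card ({y. adj c y} \<union> {y. adj d y}))"
    using neighbours[of c] neighbours[of d] by (simp add: card_insert_if)
  then have "card ?X \<le> 2 * m + 1"
    using card_Un_le[of "{y. adj c y}" "{y. adj d y}"] neighbours[of c] neighbours[of d] assms(2,3) by linarith
  also have "\<dots> < 2 ^ (m - 1)"
    using m
  proof (induction m rule: nat_induct_at_least)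
    case (Suc k)
    then show ?case by (cases k) auto
  qed simp
  finally have "card ?X < 2 ^ (m - 1)" .
  moreover have "finite ?X" using neighbours by simp
  ultimately show thesis
    using colour_avoiding[of ?X m "\<not> red c"] m that by auto
qed

text \<open>Let \<open>a\<close> and \<open>b\<close> differ in \<open>i\<close> and in
  \<open>j\<close>. If \<open>c\<close> and \<open>d\<close> agree in \<open>j\<close>, split along
  \<open>i\<close> and use \<open>j\<close> as the coordinate shared by \<open>c\<close> and
  \<open>d\<close>; otherwise one of them lies beside \<open>r\<close> in direction
  \<open>j\<close>, and splitting along \<open>j\<close> avoids the delicate placement.\<close>

lemma linked_antipodal:
  assumes "4 \<le> m" "terminals (Suc m) r g a b c d" "\<And>i. i \<le> m \<Longrightarrow> r ! i \<noteq> g ! i"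
  shows "linked (Suc m) r g a b c d"
proof -
  have good: "linked (Suc m) r g a b c d"
    if t: "terminals (Suc m) r g a b c d" and h: "i \<le> m" "a ! i = r ! i" "b ! i = g ! i"
      "c ! i = r ! i \<or> d ! i = r ! i \<or> (m = 4 \<longrightarrow> (\<exists>j\<le>m. j \<noteq> i \<and> c ! j = d ! j))" for a b c d i
  proof -
    define p where "p = r ! i"
    have len: "length r = Suc m" "length g = Suc m" "length a = Suc m" "length b = Suc m" "length c = Suc m" "length d = Suc m"
      using t by (simp_all add: terminals_def)
    have gi: "g ! i = (\<not> p)" using assms(3)[OF h(1)] p_def by auto
    obtain r' where r: "length r' = m" "r = ins i p r'" using ins_at[OF len(1) h(1) p_def[symmetric]] .
    obtain g' where g: "length g' = m" "g = ins i (\<not> p) g'" using ins_at[OF len(2) h(1) gi] .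
    obtain a' where a: "length a' = m" "a = ins i p a'" using ins_at[OF len(3) h(1) h(2)[folded p_def]] .
    obtain b' where b: "length b' = m" "b = ins i (\<not> p) b'" using ins_at[OF len(4) h(1) h(3)[unfolded gi]] .
    obtain c' where c: "length c' = m" "c = ins i (c ! i) c'" using ins_cases[OF len(5) h(1)] .
    obtain d' where d: "length d' = m" "d = ins i (d ! i) d'" using ins_cases[OF len(6) h(1)] .
    consider "c ! i = p" "d ! i = p" | "c ! i = p" "d ! i = (\<not> p)" | "c ! i = (\<not> p)" "d ! i = p"
      | "c ! i = (\<not> p)" "d ! i = (\<not> p)" by argo
    then show ?thesis
    proof cases
      case 1
      note e = c(2)[unfolded 1] d(2)[unfolded 1]
      show ?thesis
        using linked_apart_1011[OF assms(1) h(1), of p r' g' a' b' c' d'] t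
        unfolding r(2)[symmetric] g(2)[symmetric] a(2)[symmetric] b(2)[symmetric] e[symmetric] .
    next
      case 2
      note e = c(2)[unfolded 2] d(2)[unfolded 2]
      show ?thesis
        using linked_apart_1010[OF assms(1) h(1), of p r' g' a' b' c' d'] t
        unfolding r(2)[symmetric] g(2)[symmetric] a(2)[symmetric] b(2)[symmetric] e[symmetric] .
    next
      case 3
      note e = c(2)[unfolded 3] d(2)[unfolded 3]
      have "linked (Suc m) r g a b d c"
        using linked_apart_1010[OF assms(1) h(1), of p r' g' a' b' d' c'] terminals_rev2[OF t]
        unfolding r(2)[symmetric] g(2)[symmetric] a(2)[symmetric] b(2)[symmetric] e[symmetric] .
      then show ?thesis by (rule linked_rev2)
    next
      case 4
      note e = c(2)[unfolded 4] d(2)[unfolded 4]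
      have col: "red d' = red c'" "red b' \<noteq> red c'"
        using t unfolding terminals_def e b(2) g(2) red_ins by auto
      have "\<exists>k<m. c' ! k = d' ! k" if "m = 4"
      proof -
        have "\<exists>j\<le>m. j \<noteq> i \<and> c ! j = d ! j"
          using h(4) 4 that unfolding p_def by auto
        then obtain j where j: "j \<le> m" "j \<noteq> i" "c ! j = d ! j" by blast
        have "c' ! (if j < i then j else j - 1) = d' ! (if j < i then j else j - 1)"
          using ins_nth_other[of i c' j "\<not> p"] ins_nth_other[of i d' j "\<not> p"] c(1) d(1) h(1) j
          unfolding e[symmetric] by simp
        moreover have "(if j < i then j else j - 1) < m" using j h(1) by auto
        ultimately show ?thesis by blast
      qed
      then obtain y where y: "length y = m" "red y \<noteq> red c'" "y \<noteq> b'" "\<not> adj c' y" "\<not> adj d' y"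
        using far_vertex[OF assms(1) c(1) d(1) col(1), of b'] by blast
      then have "red y = red b'" using col by auto
      from linked_apart_1000[OF assms(1) h(1) _ y(1) this y(3-5), of p r' g' a'] t
      show ?thesis
        unfolding r(2)[symmetric] g(2)[symmetric] a(2)[symmetric] b(2)[symmetric] e[symmetric] by blast
    qed
  qed
  have either: "linked (Suc m) r g a b c d"
    if "i \<le> m" "a ! i \<noteq> b ! i" "c ! i = r ! i \<or> d ! i = r ! i \<or> (m = 4 \<longrightarrow> (\<exists>j\<le>m. j \<noteq> i \<and> c ! j = d ! j))" for i
  proof (cases "a ! i = r ! i")
    case True
    then have "b ! i = g ! i" using that(2) assms(3)[OF that(1)] by auto
    then show ?thesis using good[OF assms(2) that(1) True _ that(3)] by blast
  next
    case False
    then have "b ! i = r ! i" "a ! i = g ! i" using that(2) assms(3)[OF that(1)] by auto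
    then show ?thesis using good[OF terminals_rev[OF assms(2)] that(1) _ _ that(3)] linked_rev by blast
  qed
  have len: "length a = Suc m" "length b = Suc m" and ab: "a \<noteq> b" "red a = red b"
    using assms(2) by (auto simp: terminals_def)
  obtain i where i: "i \<le> m" "a ! i \<noteq> b ! i"
    using ab(1) len by (auto simp: list_eq_iff_nth_eq less_Suc_eq_le)
  obtain j where j: "j \<le> m" "j \<noteq> i" "a ! j \<noteq> b ! j"
    using adj_single[of a b i] adj_red[of a b] ab(2) i len by (auto simp: less_Suc_eq_le)
  show ?thesis
  proof (cases "c ! j = d ! j")
    case True
    then show ?thesis using either[OF i] j by blast
  next
    case False
    then have "c ! j = r ! j \<or> d ! j = r ! j" by auto
    then show ?thesis using either[OF j(1,3)] by blast
  qed
qed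

lemma linked_terminals:
  assumes "5 \<le> n" "terminals n r g a b c d"
  shows "linked n r g a b c d"
proof -
  define m where "m = n - 1"
  have m: "4 \<le> m" "n = Suc m" using assms(1) by (auto simp: m_def)
  show ?thesis
  proof (cases "\<exists>i\<le>m. r ! i = g ! i")
    case True
    then show ?thesis using linked_same_plate m assms(2) by blast
  next
    case False
    then show ?thesis using linked_antipodal m assms(2) by blast
  qed
qed

section \<open>From terminals to prescribed path coverings\<close>

lemma path_covering_two:
  assumes "conn2 adj a b c d V"
  shows "\<exists>P. path_covering V adj P \<and> path_ends ` P = {{a, b}, {c, d}}"
proof -
  obtain S T where S: "conn adj a b S" "conn adj c d T" "S \<inter> T = {}" "V = S \<union> T"
    using assms by (rule conn2E)
  obtain p where p: "p \<noteq> []" "hd p = a" "last p = b" "distinct p" "successively adj p" "set p = S"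
    using S(1) unfolding conn_list by blast
  obtain q where q: "q \<noteq> []" "hd q = c" "last q = d" "distinct q" "successively adj q" "set q = T"
    using S(2) unfolding conn_list by blast
  have "path_covering V adj {p, q}"
    using p q S(3,4) unfolding path_covering_def is_path_def by auto
  then show ?thesis
    using p(2,3) q(2,3) by (intro exI[of _ "{p, q}"]) (simp add: path_ends_def)
qed

text \<open>Paths of a covering with equal ends share a vertex and hence coincide, so the covering
  consists of exactly two paths.\<close>

lemma conn2_of_path_covering:
  assumes "path_covering V adj P" "path_ends ` P = {{a, b}, {c, d}}" "{a, b} \<noteq> {c, d}"
  shows "conn2 adj a b c d V"
proof -
  have conn: "conn adj u v (set p)" if "p \<in> P" "path_ends p = {u, v}" for p u v
  proof -
    have "conn adj (hd p) (last p) (set p)"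
      using assms(1) that(1) unfolding conn_list path_covering_def is_path_def by blast
    moreover have "hd p = u \<and> last p = v \<or> hd p = v \<and> last p = u"
      using that(2) by (auto simp: path_ends_def doubleton_eq_iff)
    ultimately show ?thesis using conn_rev[OF symp_adj] by auto
  qed
  have same: "p = q" if "p \<in> P" "q \<in> P" "path_ends p = path_ends q" for p q
  proof -
    have "hd p \<in> path_ends q" "p \<noteq> []" "q \<noteq> []"
      using that assms(1) by (auto simp: path_ends_def path_covering_def is_path_def)
    then have "hd p \<in> set p \<inter> set q" by (auto simp: path_ends_def)
    then show ?thesis using that(1,2) assms(1) unfolding path_covering_def by blast
  qed
  obtain p where p: "p \<in> P" "path_ends p = {a, b}" using assms(2) by (metis imageE insertI1)
  obtain q where q: "q \<in> P" "path_ends q = {c, d}" using assms(2) by (metis imageE insertI1 insertI2)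
  have "P \<subseteq> {p, q}"
  proof
    fix x assume x: "x \<in> P"
    then have "path_ends x \<in> {{a, b}, {c, d}}" using assms(2) by blast
    then show "x \<in> {p, q}" using same[OF x p(1)] same[OF x q(1)] p(2) q(2) by auto
  qed
  then have "P = {p, q}" using p(1) q(1) by auto
  moreover have "p \<noteq> q" using p(2) q(2) assms(3) by auto
  ultimately have "set p \<inter> set q = {}" "set p \<union> set q = V"
    using assms(1) unfolding path_covering_def by auto
  then show ?thesis
    using conn[OF p] conn[OF q] by (intro conn2I)
qed

section \<open>Colour counts of faults and of prescribed pairs\<close>

lemma red_minus_green_neutral: "red r \<Longrightarrow> green g \<Longrightarrow> red_minus_green {r, g} = 0"
proof -
  assume "red r" "green g"
  then have "{v \<in> {r, g}. red v} = {r}" "{v \<in> {r, g}. green v} = {g}"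
    by (auto simp: green_iff)
  then show ?thesis by (simp add: red_minus_green_def)
qed

lemma neutral_fault:
  assumes "is_fault n F" "mass F = 2" "charge F = 0"
  obtains r g where "F = {r, g}" "red r" "green g" "length r = n" "length g = n"
proof -
  let ?R = "{v \<in> F. red v}" and ?G = "{v \<in> F. green v}"
  have "finite F" using assms(2) unfolding mass_def by (metis card.infinite zero_neq_numeral)
  moreover have F: "F = ?R \<union> ?G" "?R \<inter> ?G = {}" by (auto simp: green_iff)
  ultimately have "card F = card ?R + card ?G"
    by (metis (no_types, lifting) card_Un_disjoint finite_Un)
  then have "card ?R = 1" "card ?G = 1"
    using assms(2,3) by (auto simp: mass_def charge_def red_minus_green_def)
  then obtain r g where "?R = {r}" "?G = {g}" by (metis card_1_singletonE)
  then have rg: "r \<in> F" "g \<in> F" "red r" "green g" "F = {r, g}" using F(1) by auto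
  then show thesis using that[of r g] assms(1) unfolding is_fault_def by auto
qed

lemma admissible_two_charged:
  assumes "terminals n r g a b c d" "red r"
  shows "admissible_ends n {r, g} 0 2 {{a, b}, {c, d}}"
proof -
  have t: "red a" "red b" "\<not> red c" "\<not> red d" "\<not> red g" "a \<noteq> b" "c \<noteq> d"
    using assms by (auto simp: terminals_def)
  let ?E = "{{a, b}, {c, d}}"
  have pairs: "red_pair {a, b}" "green_pair {c, d}" "\<not> green_pair {a, b}" "\<not> red_pair {c, d}"
    "\<not> neutral_pair {a, b}" "\<not> neutral_pair {c, d}"
    using t by (auto simp: red_pair_def green_pair_def neutral_pair_def is_pair_def green_iff)
  have ne: "{a, b} \<noteq> {c, d}" using t by auto
  have "{e \<in> ?E. green_pair e} = {{c, d}}" "{e \<in> ?E. red_pair e} = {{a, b}}"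
    "{e \<in> ?E. neutral_pair e} = {}" "{e \<in> ?E. charged_pair e} = ?E"
    using pairs unfolding charged_pair_def by auto
  moreover have "pairwise disjnt ?E" using t by (auto simp: pairwise_def disjnt_def)
  moreover have "\<forall>e\<in>?E. is_pair e \<and> e \<subseteq> hypercube n - {r, g}"
    using assms t unfolding terminals_def by (auto simp: is_pair_def)
  moreover have "red_minus_green {r, g} = 0"
    using assms(2) t(5) by (intro red_minus_green_neutral) (simp_all add: green_iff)
  ultimately show ?thesis
    unfolding admissible_ends_def in_balance_def using ne by simp
qed

text \<open>Charge 0 forces as many red as green pairs, so two charged pairs are one of each
  colour.\<close>

lemma admissible_two_chargedE:
  assumes "admissible_ends n {r, g} 0 2 \<E>" "red r" "green g" "length r = n" "length g = n"
  obtains a b c d where "\<E> = {{a, b}, {c, d}}" "terminals n r g a b c d"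
proof -
  have E: "\<And>e. e \<in> \<E> \<Longrightarrow> is_pair e \<and> e \<subseteq> hypercube n - {r, g}"
    and dis: "pairwise disjnt \<E>"
    and bal: "card {e \<in> \<E>. green_pair e} = card {e \<in> \<E>. red_pair e}"
    and zero: "card {e \<in> \<E>. neutral_pair e} = 0" and two: "card {e \<in> \<E>. charged_pair e} = 2"
    using assms(1) red_minus_green_neutral[OF assms(2,3)]
    unfolding admissible_ends_def in_balance_def by auto
  let ?R = "{e \<in> \<E>. red_pair e}" and ?G = "{e \<in> \<E>. green_pair e}"
  \<comment> \<open>Finiteness has to come first: an infinite set also has \<open>card\<close> 0,
    and absence of neutral pairs would not follow.\<close>
  have "\<E> \<subseteq> Pow (hypercube n)" using E by blast
  then have fin: "finite \<E>" by (rule finite_subset) simp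
  then have "{e \<in> \<E>. neutral_pair e} = {}" using zero by simp
  moreover have "neutral_pair e \<or> red_pair e \<or> green_pair e" if "e \<in> \<E>" for e
    using E[OF that] by (auto simp: neutral_pair_def red_pair_def green_pair_def green_iff)
  ultimately have all: "\<E> = ?R \<union> ?G" by blast
  have "?R \<inter> ?G = {}"
    by (auto simp: red_pair_def green_pair_def is_pair_def green_iff card_2_iff)
  then have "card ?R + card ?G = card (?R \<union> ?G)"
    using fin by (subst card_Un_disjoint) auto
  moreover have "{e \<in> \<E>. charged_pair e} = ?R \<union> ?G" by (auto simp: charged_pair_def)
  ultimately have "card ?R = 1" "card ?G = 1" using two bal by auto
  then obtain e f where ef: "?R = {e}" "?G = {f}" by (metis card_1_singletonE)
  then have e: "e \<in> \<E>" "red_pair e" and f: "f \<in> \<E>" "green_pair f" by auto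
  obtain a b where ab: "e = {a, b}" "a \<noteq> b" using e(2) by (auto simp: red_pair_def is_pair_def card_2_iff)
  obtain c d where cd: "f = {c, d}" "c \<noteq> d" using f(2) by (auto simp: green_pair_def is_pair_def card_2_iff)
  have "terminals n r g a b c d"
    using E[OF e(1)] E[OF f(1)] e(2) f(2) assms(2-5) ab cd
    unfolding terminals_def red_pair_def green_pair_def green_iff by auto
  moreover have "\<E> = {{a, b}, {c, d}}" using all unfolding ef ab(1) cd(1) by auto
  ultimately show thesis using that by blast
qed

lemma freely_prescribable_5:
  assumes "5 \<le> n" "is_fault n F" "mass F = 2" "charge F = 0"
  shows "freely_prescribable n F 0 2"
proof -
  obtain r g where F: "F = {r, g}" "red r" "green g" "length r = n" "length g = n"
    using neutral_fault[OF assms(2-4)] .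
  have n: "3 \<le> n" using assms(1) by simp
  obtain a where a: "length a = n" "red a = True" "a \<noteq> r" using colour_avoiding3[OF n] by metis
  obtain b where b: "length b = n" "red b = True" "b \<noteq> r" "b \<noteq> a" using colour_avoiding3[OF n] by metis
  obtain c where c: "length c = n" "red c = False" "c \<noteq> g" using colour_avoiding3[OF n] by metis
  obtain d where d: "length d = n" "red d = False" "d \<noteq> g" "d \<noteq> c" using colour_avoiding3[OF n] by metis
  have "terminals n r g a b c d"
    using F a b c d by (simp add: terminals_def green_iff)
  then have "\<exists>\<E>. admissible_ends n F 0 2 \<E>"
    using admissible_two_charged F(1,2) by blast
  moreover have "\<exists>P. path_covering (hypercube n - F) adj P \<and> path_ends ` P = \<E>"
    if adm: "admissible_ends n F 0 2 \<E>" for \<E>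
  proof -
    obtain a b c d where E: "\<E> = {{a, b}, {c, d}}" and t: "terminals n r g a b c d"
      using admissible_two_chargedE[OF adm[unfolded F(1)] F(2-5)] .
    show ?thesis
      unfolding E F(1) using path_covering_two[OF linked_terminals[OF assms(1) t, unfolded linked_def]] .
  qed
  ultimately show ?thesis unfolding freely_prescribable_def by blast
qed

text \<open>The vertices 0010 and 0011 obstruct: they are adjacent, and their other neighbours are
  \<open>r\<close>, \<open>a\<close>, \<open>b\<close> and \<open>g\<close>, \<open>c\<close>,
  \<open>d\<close>. Neither is a terminal, so each needs two neighbours on its path. If they are
  consecutive, a path joins \<open>a\<close> or \<open>b\<close> to \<open>c\<close> or
  \<open>d\<close>; otherwise the paths are \<open>a\<close>, 0010, \<open>b\<close> and
  \<open>c\<close>, 0011, \<open>d\<close>, which leave vertices uncovered.\<close>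

lemma not_freely_prescribable_4:
  "\<exists>F. is_fault 4 F \<and> mass F = 2 \<and> charge F = 0 \<and> \<not> freely_prescribable 4 F 0 2"
proof -
  define r g where "r = [False, False, False, False]" and "g = [False, False, False, True]"
  define a b c d where "a = [False, True, True, False]" and "b = [True, False, True, False]"
    and "c = [True, False, True, True]" and "d = [False, True, True, True]"
  note defs = r_def g_def a_def b_def c_def d_def
  have t: "terminals 4 r g a b c d" and r: "red r" and g: "green g"
    by (simp_all add: terminals_def defs red_code green_iff)
  let ?R = "remove1 a (remove1 r (remove1 g (cube 4)))"
  have R: "set ?R = hypercube 4 - {r, g} - {a}" "insert a (set ?R) = hypercube 4 - {r, g}" "length ?R = 13"
    by (auto simp: set_cube distinct_cube length_remove1 length_cube defs)
  have "\<not> conn2 adj a b c d (hypercube 4 - {r, g})"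
  proof
    assume "conn2 adj a b c d (hypercube 4 - {r, g})"
    then have "conn (jump adj b c) a d (hypercube 4 - {r, g})"
      by (subst (asm) conn2_jump) (simp_all add: defs)
    then have "hamiltonian (jump adj b c) d 13 a ?R"
      using hamiltonian_iff[of ?R 13 a "jump adj b c" d] R by (simp add: distinct_cube)
    then show False using no_cover_check unfolding defs by blast
  qed
  moreover have "{a, b} \<noteq> {c, d}" by (simp add: defs doubleton_eq_iff)
  ultimately have "\<not> (\<exists>P. path_covering (hypercube 4 - {r, g}) adj P \<and> path_ends ` P = {{a, b}, {c, d}})"
    using conn2_of_path_covering[of "hypercube 4 - {r, g}" _ a b c d] by metis
  then have "\<not> freely_prescribable 4 {r, g} 0 2"
    using admissible_two_charged[OF t r] unfolding freely_prescribable_def by metis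
  moreover have "is_fault 4 {r, g}" "mass {r, g} = 2" "charge {r, g} = 0"
    using red_minus_green_neutral[OF r g] by (simp_all add: is_fault_def mass_def charge_def defs)
  ultimately show ?thesis by blast
qed

theorem lemma5p7: "least_dim 2 0 0 2 = Some 5"
proof -
  \<comment> \<open>Here 6 is \<open>2 + 0 + 2 * 0 + 2 * 2\<close>.\<close>
  have "log 2 6 \<le> (5 :: real)" by (simp add: log_le_iff)
  then have mem: "5 \<in> dims 2 0 0 2"
    using freely_prescribable_5 by (simp add: dims_def)
  have "5 \<le> m" if "m \<in> dims 2 0 0 2" for m
  proof (rule ccontr)
    assume "\<not> 5 \<le> m"
    then have "m \<le> 4" by simp
    \<comment> \<open>Failure in dimension 4 refutes every \<open>m \<le> 4\<close> at once, since
      membership quantifies over all \<open>n \<ge> m\<close>.\<close>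
    then show False
      using that not_freely_prescribable_4 unfolding dims_def by blast
  qed
  then have "(LEAST m. m \<in> dims 2 0 0 2) = 5"
    using mem by (intro Least_equality)
  then show ?thesis
    using mem unfolding least_dim_def by auto
qed

end
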